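(* Let $\varepsilon=2^{-j}$ ($j$ a positive integer) be a constant lower bound on all item sizes. The online algorithm described in the context produces, on every instance $I$, a packing $P$ with $P(I)\le 3\,\mathrm{OPT}(I)+O(\log(1/\varepsilon))$ and $P_c(I)\le 1.7\,\mathrm{OPT}(I_c)+O(\log(1/\varepsilon))$ for every colour $c$; thus it is a $(3,1.7)$-approximation algorithm. Moreover, it uses space at most $O(m)$ (at most $O(m)$ bins are open at any time), where $m$ is the number of colours.
   Context: Online coloured bin packing: items arrive one by one, each with a size $s(e)\in[\varepsilon,1]$ and a colour $c(e)\in\{1,\dots,m\}$, and must be placed irrevocably into unit-capacity bins. $I_c$ is the set of items of colour $c$; $\mathrm{OPT}(I)$, $\mathrm{OPT}(I_c)$ are the offline minimum numbers of bins to pack $I$, $I_c$; $P(I)$ is the number of bins of the packing and $P_c(I)$ the number of bins containing an item of colour $c$. For $i=1,\dots,j$, a level-$i$ bin is divided into exactly $1/(2^i\varepsilon)$ regions, each of size $2^i\varepsilon$ (level-$i$ regions); each region contains items of at most one colour. Modified Next Fit (MNF) packs an item $e$ of colour $c$: let $i$ be the highest level at which an item of colour $c$ is packed ($i=1$ if $e$ is the first item of colour $c$); if $e$ fits in colour $c$'s level-$i$ region, pack it there; otherwise let $l>i$ be the lowest level with $2^l\varepsilon\ge s(e)$ and pack $e$ into a new level-$l$ region (creating a new level-$l$ bin if no unused level-$l$ region exists). A colour has level $i$ if $i$ is the largest level of a bin containing items of that colour. The algorithm: an item of colour $c$ is packed with MNF into these non-isolated bins if colour $c$ has level $<j$; otherwise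 it is packed with Bounded Best-Fit (at most 2 open bins; an item goes into the fullest open bin with room, otherwise the fullest open bin is closed and a new bin opened) into isolated bins containing only items of colour $c$ (the last level-$j$ bin of colour $c$ is also considered isolated). *)

theory Defs
  imports Complex_Main "HOL-Library.Multiset"
begin

section \<open>Coloured items, packings and optima\<close>

datatype item = Item (sz: real) (col: nat)

definition load :: "item multiset \<Rightarrow> real" where
  "load X = (\<Sum>e\<in>#X. sz e)"

definition has_colour :: "nat \<Rightarrow> item multiset \<Rightarrow> bool" where
  "has_colour c X \<longleftrightarrow> (\<exists>e\<in>#X. col e = c)"

definition is_instance :: "real \<Rightarrow> nat \<Rightarrow> item list \<Rightarrow> bool" where
  "is_instance \<epsilon> m I \<longleftrightarrow> (\<forall>e\<in>set I. \<epsilon> \<le> sz e \<and> sz e \<le> 1 \<and> col e \<in> {1..m})"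

text \<open>A packing is the list of the contents of its bins. Items with the same size and colour
  are told apart by multiplicity.\<close>

definition is_packing :: "item multiset list \<Rightarrow> item multiset \<Rightarrow> bool" where
  "is_packing P X \<longleftrightarrow> sum_list P = X \<and> (\<forall>b\<in>set P. load b \<le> 1)"

definition OPT :: "item multiset \<Rightarrow> nat" where
  "OPT X = (LEAST n. \<exists>P. is_packing P X \<and> length P = n)"

definition colour_class :: "item list \<Rightarrow> nat \<Rightarrow> item multiset" where
  "colour_class I c = {#e \<in># mset I. col e = c#}"

definition colour_bins :: "nat \<Rightarrow> item multiset list \<Rightarrow> nat" where
  "colour_bins c P = length (filter (has_colour c) P)"

text \<open>An algorithm is a relation between instances and the packings it may output, so that
  choices which its description leaves open (ties) are covered. The additive constant of an
  \<open>(\<alpha>, \<beta>)\<close>-approximation may depend on the lower bound \<open>\<epsilon>\<close> on item sizes, but not on the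
  instance or the number of colours.\<close>

definition approximation_algorithm ::
    "real \<Rightarrow> real \<Rightarrow> real \<Rightarrow> (item list \<Rightarrow> item multiset list \<Rightarrow> bool) \<Rightarrow> bool" where
  "approximation_algorithm \<epsilon> \<alpha> \<beta> A \<longleftrightarrow>
     (\<exists>K. \<forall>m I. is_instance \<epsilon> m I \<longrightarrow>
        (\<exists>P. A I P) \<and>
        (\<forall>P. A I P \<longrightarrow>
           is_packing P (mset I) \<and>
           real (length P) \<le> \<alpha> * real (OPT (mset I)) + K \<and>
           (\<forall>c\<in>{1..m}. real (colour_bins c P) \<le> \<beta> * real (OPT (colour_class I c)) + K)))"


section \<open>The algorithm\<close>

definition eps :: "nat \<Rightarrow> real" where
  "eps j = 1 / 2 ^ j"

definition region_size :: "nat \<Rightarrow> nat \<Rightarrow> real" where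
  "region_size j l = 2 ^ l * eps j"

text \<open>A level-\<open>j\<close> bin consists of a single region, namely the whole bin, and therefore has a
  single colour. The isolated bins are exactly the level-\<open>j\<close> bins: the one in which Modified Next
  Fit places the first item of a colour reaching level \<open>j\<close>, and the ones opened afterwards for
  that colour by Bounded Best-Fit. Only isolated bins are ever marked as closed.\<close>

record bin =
  level :: nat
  regions :: "item multiset list"
  closed :: bool

definition contents :: "bin \<Rightarrow> item multiset" where
  "contents b = sum_list (regions b)"

definition new_bin :: "nat \<Rightarrow> nat \<Rightarrow> bin" where
  "new_bin j l = \<lparr>level = l, regions = replicate (2 ^ (j - l)) {#}, closed = False\<rparr>"

lemma length_regions_new_bin:
  assumes "l \<le> j"
  shows "real (length (regions (new_bin j l))) = 1 / region_size j l"
proof -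
  have "(2::real) ^ (j - l) = 2 ^ j / 2 ^ l"
    using assms by (simp add: power_diff)
  then show ?thesis
    by (simp add: new_bin_def region_size_def eps_def)
qed

definition put :: "item \<Rightarrow> nat \<Rightarrow> nat \<Rightarrow> bin list \<Rightarrow> bin list" where
  "put e k r B = B[k := (B ! k)\<lparr>regions := (regions (B ! k))[r := add_mset e (regions (B ! k) ! r)]\<rparr>]"

definition put_new :: "nat \<Rightarrow> item \<Rightarrow> nat \<Rightarrow> bin list \<Rightarrow> bin list" where
  "put_new j e l B = put e (length B) 0 (B @ [new_bin j l])"

definition close_bin :: "nat \<Rightarrow> bin list \<Rightarrow> bin list" where
  "close_bin k B = B[k := (B ! k)\<lparr>closed := True\<rparr>]"

text \<open>The level of a colour without items is 0, below all levels of bins.\<close>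

definition colour_level :: "bin list \<Rightarrow> nat \<Rightarrow> nat" where
  "colour_level B c = Max (insert 0 (level ` {b \<in> set B. has_colour c (contents b)}))"

text \<open>The pairs (bin, region) such that the region is at the level of the colour of \<open>e\<close>, contains
  this colour, and has room for \<open>e\<close>.\<close>

definition fitting_regions :: "nat \<Rightarrow> bin list \<Rightarrow> item \<Rightarrow> (nat \<times> nat) set" where
  "fitting_regions j B e =
     {(k, r). k < length B \<and> r < length (regions (B ! k)) \<and>
        level (B ! k) = colour_level B (col e) \<and>
        has_colour (col e) (regions (B ! k) ! r) \<and>
        load (regions (B ! k) ! r) + sz e \<le> region_size j (level (B ! k))}"

definition unused_regions :: "bin list \<Rightarrow> nat \<Rightarrow> (nat \<times> nat) set" where
  "unused_regions B l =
     {(k, r). k < length B \<and> r < length (regions (B ! k)) \<and>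
        level (B ! k) = l \<and> regions (B ! k) ! r = {#}}"

text \<open>For the first item of a colour this is the lowest level \<open>\<ge> 1\<close> whose regions can hold it. So
  a colour receives its level-1 region only when its first item goes there.\<close>

definition next_level :: "nat \<Rightarrow> bin list \<Rightarrow> item \<Rightarrow> nat" where
  "next_level j B e = (LEAST l. colour_level B (col e) < l \<and> sz e \<le> region_size j l)"

definition open_isolated :: "nat \<Rightarrow> bin list \<Rightarrow> nat \<Rightarrow> nat set" where
  "open_isolated j B c =
     {k. k < length B \<and> level (B ! k) = j \<and> \<not> closed (B ! k) \<and> has_colour c (contents (B ! k))}"

definition has_room :: "bin list \<Rightarrow> item \<Rightarrow> nat \<Rightarrow> bool" where
  "has_room B e k \<longleftrightarrow> load (contents (B ! k)) + sz e \<le> 1"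

inductive step :: "nat \<Rightarrow> bin list \<Rightarrow> item \<Rightarrow> bin list \<Rightarrow> bool" for j where
  mnf_fit:
    "\<lbrakk>colour_level B (col e) < j; (k, r) \<in> fitting_regions j B e\<rbrakk>
     \<Longrightarrow> step j B e (put e k r B)"
| mnf_unused_region:
    "\<lbrakk>colour_level B (col e) < j; fitting_regions j B e = {};
      (k, r) \<in> unused_regions B (next_level j B e)\<rbrakk>
     \<Longrightarrow> step j B e (put e k r B)"
| mnf_new_bin:
    "\<lbrakk>colour_level B (col e) < j; fitting_regions j B e = {};
      unused_regions B (next_level j B e) = {}\<rbrakk>
     \<Longrightarrow> step j B e (put_new j e (next_level j B e) B)"
| bbf_fit:
    "\<lbrakk>j \<le> colour_level B (col e);
      is_arg_max (\<lambda>k. load (contents (B ! k)))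
        (\<lambda>k. k \<in> open_isolated j B (col e) \<and> has_room B e k) k\<rbrakk>
     \<Longrightarrow> step j B e (put e k 0 B)"
| bbf_new_bin:
    "\<lbrakk>j \<le> colour_level B (col e); \<forall>k\<in>open_isolated j B (col e). \<not> has_room B e k;
      card (open_isolated j B (col e)) < 2\<rbrakk>
     \<Longrightarrow> step j B e (put_new j e j B)"
| bbf_close:
    "\<lbrakk>j \<le> colour_level B (col e); \<forall>k\<in>open_isolated j B (col e). \<not> has_room B e k;
      \<not> card (open_isolated j B (col e)) < 2;
      is_arg_max (\<lambda>k. load (contents (B ! k))) (\<lambda>k. k \<in> open_isolated j B (col e)) k\<rbrakk>
     \<Longrightarrow> step j B e (put_new j e j (close_bin k B))"

inductive run :: "nat \<Rightarrow> item list \<Rightarrow> bin list \<Rightarrow> bool" for j where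
  run_Nil: "run j [] []"
| run_snoc: "\<lbrakk>run j I B; step j B e B'\<rbrakk> \<Longrightarrow> run j (I @ [e]) B'"

definition produces :: "nat \<Rightarrow> item list \<Rightarrow> item multiset list \<Rightarrow> bool" where
  "produces j I P \<longleftrightarrow> (\<exists>B. run j I B \<and> P = map contents B)"

text \<open>Bins of level below \<open>j\<close> are never closed, hence all of them are counted here.\<close>

definition open_bins :: "bin list \<Rightarrow> nat" where
  "open_bins B = length (filter (\<lambda>b. \<not> closed b) B)"

end

theory Submission
  imports Defs
begin

text \<open>For \<open>P_c\<close>, an item of size \<open>x\<close> gets weight \<open>6/5 x + bonus x\<close>, so that a bin of any packing
  weighs at most 1.7. It remains to show that Bounded Best-Fit packs weight at least 1 per bin on
  average, up to a constant. That is, the account \<open>T\<close>, the total bonus so far minus the sum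
  of the deficits \<open>1 - 6/5 x\<close> of the closed bins (\<open>x\<close> being the load), must stay bounded below. Two open bins of loads
  \<open>y \<le> x\<close> always satisfy \<open>x + y > 1\<close>, and an item that goes to a new bin, or that raises the emptier
  bin, is larger than \<open>1 - x\<close>; so half of the deficit of a closed bin is paid by the first item of
  the new bin, and the other half was paid by the item that raised the emptier of two earlier open
  bins above \<open>1/2\<close>; an item larger than \<open>1/2\<close> pays for a closed bin on its own.

  For the total, let \<open>A l\<close> be the load of a colour on level \<open>l\<close>. When level \<open>l\<close> is opened,
  \<open>A (l - 1) + A l\<close> is at least the region size of level \<open>l - 1\<close>, which is a third of the sizes of
  a level-\<open>(l - 1)\<close> and a level-\<open>l\<close> region; pairing the levels from the top shows that all regions
  of a colour have total size at most three times its load. (Two or more isolated bins are half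
  full on average.) Unused regions fill less than one bin per level.\<close>

lemma load_empty [simp]: "load {#} = 0"
  and load_add_mset [simp]: "load (add_mset e X) = sz e + load X"
  and load_union [simp]: "load (X + Y) = load X + load Y"
  by (simp_all add: load_def)

lemma load_nonneg: "(\<And>e. e \<in># X \<Longrightarrow> 0 \<le> sz e) \<Longrightarrow> 0 \<le> load X"
  by (induction X) (auto intro: add_nonneg_nonneg)

section \<open>The weight function\<close>

text \<open>The excess over 6/5 x in the classical weight function of the 17/10 analysis of First
  Fit and Best Fit. For x from 2/3 to 5/6 its value at 1 - x is (1 - 6/5 x) / 2, half of the deficit
  of a bin of load x.\<close>

definition bonus :: "real \<Rightarrow> real" where
  "bonus x = (if x \<le> 1/6 then 0 else if x \<le> 1/3 then 3/5 * x - 1/10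
              else if x \<le> 1/2 then 1/10 else 2/5)"

definition weight :: "real \<Rightarrow> real" where
  "weight x = 6/5 * x + bonus x"

definition total_bonus :: "item multiset \<Rightarrow> real" where
  "total_bonus X = (\<Sum>e\<in>#X. bonus (sz e))"

definition total_weight :: "item multiset \<Rightarrow> real" where
  "total_weight X = (\<Sum>e\<in>#X. weight (sz e))"

lemma total_bonus_simps [simp]:
  "total_bonus {#} = 0"
  "total_bonus (add_mset e X) = bonus (sz e) + total_bonus X"
  "total_bonus (X + Y) = total_bonus X + total_bonus Y"
  by (simp_all add: total_bonus_def)

lemma total_weight_simps [simp]:
  "total_weight {#} = 0"
  "total_weight (add_mset e X) = weight (sz e) + total_weight X"
  "total_weight (X + Y) = total_weight X + total_weight Y"
  by (simp_all add: total_weight_def)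

lemma total_weight_eq: "total_weight X = 6/5 * load X + total_bonus X"
  by (induction X) (simp_all add: weight_def)

lemma bonus_nonneg: "0 \<le> bonus x"
  by (simp add: bonus_def)

text \<open>If both arguments exceed 1/6, then both are below 1/3 and the left side is 3/5 (a + b) -
  1/5, at most 1/10, while the sum exceeds 1/3. Otherwise one bonus is 0 and monotonicity
  suffices.\<close>

lemma bonus_superadditive:
  "0 \<le> a \<Longrightarrow> 0 \<le> b \<Longrightarrow> a + b \<le> 1/2 \<Longrightarrow> bonus a + bonus b \<le> bonus (a + b)"
  by (auto simp: bonus_def distrib_left)

text \<open>The slope is the ratio at 1/3, where both sides equal 1/10.\<close>

lemma bonus_le_linear: "0 \<le> x \<Longrightarrow> x \<le> 1/2 \<Longrightarrow> bonus x \<le> 3/10 * x"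
  by (auto simp: bonus_def)

text \<open>By superadditivity the items can be merged one after the other into a single
  item.\<close>

lemma total_bonus_le_bonus_load:
  assumes "\<And>e. e \<in># X \<Longrightarrow> 0 \<le> sz e" "load X \<le> 1/2"
  shows "total_bonus X \<le> bonus (load X)"
  using assms
proof (induction X)
  case (add e X)
  have "0 \<le> load X" "0 \<le> sz e" using add.prems load_nonneg[of X] by auto
  then show ?case
    using add bonus_superadditive[of "sz e" "load X"] by force
qed (simp add: bonus_nonneg)

text \<open>With an item above 1/2 the bonuses are 2/5 for it and at most 1/10 for the rest, so the
  weight is at most 6/5 + 1/2. Without one the linear bound gives 6/5 + 3/10.\<close>

lemma total_weight_bin_le:
  assumes nonneg: "\<And>e. e \<in># X \<Longrightarrow> 0 \<le> sz e" and "load X \<le> 1"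
  shows "total_weight X \<le> 17/10"
proof (cases "\<exists>e\<in>#X. 1/2 < sz e")
  case True
  then obtain e Y where X: "X = add_mset e Y" and e: "1/2 < sz e"
    by (metis insert_DiffM)
  have "load Y \<le> 1/2" using X e assms(2) by simp
  moreover have "total_bonus Y \<le> bonus (load Y)"
    using X nonneg \<open>load Y \<le> 1/2\<close> by (intro total_bonus_le_bonus_load) auto
  moreover have "bonus (load Y) \<le> 1/10"
    using \<open>load Y \<le> 1/2\<close> by (auto simp: bonus_def)
  ultimately show ?thesis
    using assms(2) e unfolding total_weight_eq X
    by (simp add: bonus_def[of "sz e"] distrib_left)
next
  case False
  have "total_bonus X \<le> 3/10 * load X"
    using nonneg False
  proof (induction X)
    case (add e X)
    then show ?case using bonus_le_linear[of "sz e"] by (fastforce simp: not_less)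
  qed simp
  then show ?thesis using assms(2) by (simp add: total_weight_eq)
qed

lemma total_weight_nonneg: "(\<And>e. e \<in># X \<Longrightarrow> 0 \<le> sz e) \<Longrightarrow> 0 \<le> total_weight X"
  by (induction X) (auto simp: weight_def intro!: add_nonneg_nonneg bonus_nonneg)

section \<open>Load and weight as lower bounds on the optimum\<close>

lemma OPT_packing:
  assumes "\<And>e. e \<in># X \<Longrightarrow> sz e \<le> 1"
  obtains P where "is_packing P X" "length P = OPT X"
proof -
  have "\<exists>P. is_packing P X"
    using assms
  proof (induction X)
    case empty
    then show ?case by (intro exI[of _ "[]"]) (simp add: is_packing_def)
  next
    case (add e X)
    then obtain P where "is_packing P X" by auto
    with add.prems show ?case
      by (intro exI[of _ "{#e#} # P"]) (simp add: is_packing_def)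
  qed
  then have "\<exists>n P. is_packing P X \<and> length P = n" by auto
  then have "\<exists>P. is_packing P X \<and> length P = OPT X"
    unfolding OPT_def by (rule LeastI_ex)
  then show ?thesis using that by auto
qed

lemma load_le_OPT:
  assumes "\<And>e. e \<in># X \<Longrightarrow> sz e \<le> 1"
  shows "load X \<le> OPT X"
proof -
  obtain P where P: "is_packing P X" "length P = OPT X" using OPT_packing assms by blast
  have "load (sum_list Q) \<le> length Q" if "\<forall>b\<in>set Q. load b \<le> 1" for Q
    using that by (induction Q) auto
  from this[of P] P show ?thesis by (simp add: is_packing_def)
qed

lemma total_weight_le_OPT:
  assumes "\<And>e. e \<in># X \<Longrightarrow> 0 \<le> sz e \<and> sz e \<le> 1"
  shows "total_weight X \<le> 17/10 * OPT X"
proof -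
  obtain P where P: "is_packing P X" "length P = OPT X" using OPT_packing assms by blast
  have "total_weight (sum_list Q) \<le> 17/10 * length Q"
    if "\<forall>b\<in>set Q. load b \<le> 1" "\<forall>e\<in>#sum_list Q. 0 \<le> sz e" for Q
    using that
  proof (induction Q)
    case (Cons b Q)
    have "total_weight b \<le> 17/10" using Cons.prems by (intro total_weight_bin_le) auto
    with Cons show ?case by (auto simp: field_simps)
  qed simp
  moreover have "sum_list P = X" "\<forall>b\<in>set P. load b \<le> 1"
    using P by (auto simp: is_packing_def)
  ultimately show ?thesis using P(2) assms by metis
qed

section \<open>Bounded Best-Fit on the loads of the open bins\<close>

text \<open>The value that \<open>T + 3/10\<close> must have reached when both open bins are more than half full and
  the fuller one has load \<open>x\<close>: for \<open>x \<ge> 2/3\<close> half of the deficit \<open>1 - 6/5 x\<close>; for \<open>x < 2/3\<close> all of it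
  but \<open>1/10\<close>, the bonus of the item that causes the closing.\<close>

definition reserve :: "real \<Rightarrow> real" where
  "reserve x = max 0 (max (1/2 - 3/5 * x) (9/10 - 6/5 * x))"

text \<open>\<open>L\<close> holds the loads of the open isolated bins of one colour,
  \<open>T\<close> is the account. While the emptier of two bins is at most half full, an item
  causing a closing exceeds 1/2 and pays alone. Afterwards a smaller item can cause it, so the
  reserve must be available.\<close>

definition bbf_inv :: "real multiset \<Rightarrow> real \<Rightarrow> bool" where
  "bbf_inv L T \<longleftrightarrow> (L = {#} \<and> 0 \<le> T) \<or> (\<exists>x. L = {#x#} \<and> 0 \<le> T) \<or>
     (\<exists>x y. L = {#x, y#} \<and> y \<le> x \<and> 1 < x + y \<and> - 3/10 \<le> T \<and>
        (1/2 < y \<longrightarrow> reserve x - 3/10 \<le> T))"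

lemma bbf_inv_pairD:
  assumes "bbf_inv {#x, y#} T" "y \<le> x"
  shows "1 < x + y" "- 3/10 \<le> T" "1/2 < y \<Longrightarrow> reserve x - 3/10 \<le> T"
  using assms by (auto simp: bbf_inv_def add_eq_conv_ex)

lemma bbf_inv_pairI:
  assumes "1 < x + y" "- 3/10 \<le> T"
    "1/2 < x \<Longrightarrow> 1/2 < y \<Longrightarrow> reserve (max x y) - 3/10 \<le> T"
  shows "bbf_inv {#x, y#} T"
proof (cases "y \<le> x")
  case True
  then have "1/2 < x" using assms(1) by auto
  then show ?thesis using True assms unfolding bbf_inv_def
    by (intro disjI2 exI[of _ x] exI[of _ y]) (auto simp: max_def)
next
  case False
  then have "1/2 < y" using assms(1) by auto
  then show ?thesis using False assms unfolding bbf_inv_def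
    by (intro disjI2 exI[of _ y] exI[of _ x]) (auto simp: max_def)
qed

lemma bbf_inv_sizeD: "bbf_inv L T \<Longrightarrow> size L \<le> 2 \<and> - 3/10 \<le> T"
  by (auto simp: bbf_inv_def)

lemma reserve_antimono: "x \<le> y \<Longrightarrow> reserve y \<le> reserve x"
  by (auto simp: reserve_def)

lemma size_less_2_cases:
  assumes "size L < (2::nat)" obtains "L = {#}" | x where "L = {#x#}"
  using assms by (cases L) (auto simp: less_Suc_eq numeral_2_eq_2)

text \<open>Raising the fuller bin only lowers the required reserve. Raising the emptier bin matters
  when it crosses 1/2: the fuller bin had no room, so the item is large enough for its bonus to lift
  the account from -3/10 to the required level.\<close>

lemma bbf_inv_fit:
  assumes inv: "bbf_inv (add_mset x N) T" and s: "0 \<le> s" "x + s \<le> 1"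
    and best: "\<And>y. y \<in># N \<Longrightarrow> y + s \<le> 1 \<Longrightarrow> y \<le> x"
  shows "bbf_inv (add_mset (x + s) N) (T + bonus s)"
proof -
  have "size N < 2" using bbf_inv_sizeD[OF inv] by simp
  then show ?thesis
  proof (cases rule: size_less_2_cases)
    case 1
    with inv show ?thesis using bonus_nonneg[of s] by (auto simp: bbf_inv_def)
  next
    case (2 y)
    show ?thesis
    proof (cases "y \<le> x")
      case True
      note D = bbf_inv_pairD[OF inv[unfolded 2] True]
      show ?thesis unfolding 2
      proof (rule bbf_inv_pairI)
        assume "1/2 < y"
        then have "reserve x - 3/10 \<le> T" by (rule D)
        moreover have "reserve (max (x + s) y) \<le> reserve x"
          using s True by (intro reserve_antimono) auto
        ultimately show "reserve (max (x + s) y) - 3 / 10 \<le> T + bonus s"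
          using bonus_nonneg[of s] by linarith
      qed (use D s bonus_nonneg[of s] in auto)
    next
      case False
      \<comment> \<open>This is where best fit enters: the item goes to the emptier bin only if the
        fuller one has no room.\<close>
      then have yx: "x \<le> y" and ys: "1 < y + s" using best[of y] 2 by force+
      have inv': "bbf_inv {#y, x#} T" using inv 2 by (simp add: add_mset_commute)
      note D = bbf_inv_pairD[OF inv' yx]
      have "reserve (max (x + s) y) - 3 / 10 \<le> T + bonus s" if "1/2 < x + s"
      proof (cases "1/2 < x")
        case True
        then have "reserve y - 3/10 \<le> T" by (rule D)
        moreover have "reserve (max (x + s) y) \<le> reserve y"
          by (intro reserve_antimono) auto
        ultimately show ?thesis using bonus_nonneg[of s] by linarith
      next
        case False
        show ?thesis
        proof (cases "2/3 \<le> y")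
          case True
          have "reserve (max (x + s) y) \<le> reserve y"
            by (intro reserve_antimono) auto
          also have "reserve y \<le> bonus s"
            using True ys s unfolding bonus_def reserve_def by auto
          finally show ?thesis using D(2) by linarith
        next
          case False
          \<comment> \<open>Since y < 2/3, both x and s exceed 1 - y > 1/3. The raised bin reaches
            2/3, where the reserve is 1/10, the least bonus of an item above 1/3.\<close>
          then have "2/3 \<le> x + s" "1/3 < s" using D(1) ys by linarith+
          then have "reserve (max (x + s) y) \<le> reserve (2/3)"
            by (intro reserve_antimono) (simp add: le_max_iff_disj)
          also have "\<dots> \<le> bonus s"
            using \<open>1/3 < s\<close> by (auto simp: reserve_def bonus_def)
          finally have "reserve (max (x + s) y) \<le> bonus s" .
          then show ?thesis using D(2) by linarith
        qed
      qed
      then show ?thesis unfolding 2 using D s bonus_nonneg[of s]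
        by (intro bbf_inv_pairI) auto
    qed
  qed
qed

text \<open>With at most one open bin the account is nonnegative, which already covers the reserve,
  at most 3/10 for loads above 1/2.\<close>

lemma bbf_inv_open:
  assumes inv: "bbf_inv L T" and "size L < 2" and full: "\<And>y. y \<in># L \<Longrightarrow> 1 < y + s"
  shows "bbf_inv (add_mset s L) (T + bonus s)"
  using assms(2)
proof (cases rule: size_less_2_cases)
  case 1
  then show ?thesis using inv bonus_nonneg[of s] by (auto simp: bbf_inv_def)
next
  case (2 x)
  then have "0 \<le> T" "1 < x + s" using inv full by (auto simp: bbf_inv_def)
  then show ?thesis unfolding 2 using bonus_nonneg[of s]
    by (intro bbf_inv_pairI) (auto simp: reserve_def max_def)
qed

text \<open>The deficit of the closed bin is paid by its reserve together with the bonus of the new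
  item, or by the bonus alone if no reserve was built up.\<close>

lemma bbf_inv_close:
  assumes inv: "bbf_inv (add_mset x N) T" and "N \<noteq> {#}"
    and full: "\<And>y. y \<in># N \<Longrightarrow> y \<le> x \<and> 1 < y + s"
  shows "bbf_inv (add_mset s N) (T + bonus s - (1 - 6/5 * x))" "1/2 < x"
proof -
  have "size N < 2" using bbf_inv_sizeD[OF inv] by simp
  then obtain y where N: "N = {#y#}" using assms(2) by (auto elim: size_less_2_cases)
  have yx: "y \<le> x" and ys: "1 < y + s" using full[of y] N by auto
  note D = bbf_inv_pairD[OF inv[unfolded N] yx]
  show x: "1/2 < x" using D(1) yx by linarith
  show "bbf_inv (add_mset s N) (T + bonus s - (1 - 6/5 * x))"
  proof (cases "1/2 < y")
    case True
    note R = D(3)[OF True]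
    show ?thesis
    proof (cases "1/2 < s")
      case True
      \<comment> \<open>3/10 is the reserve at 1/2, so two bins above 1/2 again need only a
        nonnegative account.\<close>
      have "reserve (max s y) \<le> 3/10"
        using reserve_antimono[of "1/2" "max s y"] True by (auto simp: reserve_def[of "1/2"])
      \<comment> \<open>The branch 9/10 - 6/5 x of the reserve and the bonus 2/5 give exactly
        0.\<close>
      moreover have "0 \<le> T + bonus s - (1 - 6/5 * x)"
        using R True x by (auto simp: reserve_def bonus_def)
      ultimately show ?thesis unfolding N using ys by (intro bbf_inv_pairI) auto
    next
      case False
      \<comment> \<open>From s > 1 - y and y \<le> x follows s > 1 - x. For x < 2/3 the bonus 1/10
        completes the reserve; for x from 2/3 to 5/6 the bonus covers the second half of the
        deficit; beyond 5/6 there is no deficit.\<close>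
      have "- 3/10 \<le> T + bonus s - (1 - 6/5 * x)"
        using R False ys yx unfolding reserve_def bonus_def by (auto split: if_splits)
      then show ?thesis unfolding N using ys False by (intro bbf_inv_pairI) auto
    qed
  next
    case False
    then have "1/2 < s" using ys by linarith
    \<comment> \<open>As x > 1/2, the deficit is below 2/5, the bonus of an item above 1/2.\<close>
    then have "- 3/10 \<le> T + bonus s - (1 - 6/5 * x)"
      using D(2) x by (auto simp: bonus_def)
    then show ?thesis unfolding N using ys False by (intro bbf_inv_pairI) auto
  qed
qed

section \<open>The packing of a single colour\<close>

datatype slot = Slot (slot_level: nat) (slot_closed: bool) (slot_items: "item multiset")

definition fill :: "item \<Rightarrow> slot \<Rightarrow> slot" where
  "fill e s = Slot (slot_level s) (slot_closed s) (add_mset e (slot_items s))"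

lemma fill_simps [simp]:
  "slot_level (fill e s) = slot_level s"
  "slot_closed (fill e s) = slot_closed s"
  "slot_items (fill e s) = add_mset e (slot_items s)"
  by (simp_all add: fill_def)

abbreviation slot_load :: "slot \<Rightarrow> real" where
  "slot_load s \<equiv> load (slot_items s)"

definition at_level :: "nat \<Rightarrow> slot multiset \<Rightarrow> slot multiset" where
  "at_level l Q = filter_mset (\<lambda>s. slot_level s = l) Q"

definition open_slots :: "nat \<Rightarrow> slot multiset \<Rightarrow> slot multiset" where
  "open_slots j Q = filter_mset (\<lambda>s. slot_level s = j \<and> \<not> slot_closed s) Q"

definition closed_slots :: "nat \<Rightarrow> slot multiset \<Rightarrow> slot multiset" where
  "closed_slots j Q = filter_mset (\<lambda>s. slot_level s = j \<and> slot_closed s) Q"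

lemma at_level_simps [simp]:
  "at_level l {#} = {#}"
  "at_level l (add_mset s Q) = (if slot_level s = l then add_mset s (at_level l Q) else at_level l Q)"
  by (simp_all add: at_level_def)

lemma open_slots_simps [simp]:
  "open_slots j {#} = {#}"
  "open_slots j (add_mset s Q) =
     (if slot_level s = j \<and> \<not> slot_closed s then add_mset s (open_slots j Q) else open_slots j Q)"
  by (simp_all add: open_slots_def)

lemma closed_slots_simps [simp]:
  "closed_slots j {#} = {#}"
  "closed_slots j (add_mset s Q) =
     (if slot_level s = j \<and> slot_closed s then add_mset s (closed_slots j Q) else closed_slots j Q)"
  by (simp_all add: closed_slots_def)

lemma at_level_eq_open_closed: "at_level j Q = open_slots j Q + closed_slots j Q"
  by (induction Q) auto

lemma at_level_empty_iff: "at_level l Q = {#} \<longleftrightarrow> (\<forall>s\<in>#Q. slot_level s \<noteq> l)"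
  by (induction Q) auto

definition top_level :: "slot multiset \<Rightarrow> nat" where
  "top_level Q = Max (insert 0 (slot_level ` set_mset Q))"

lemma slot_level_le_top: "s \<in># Q \<Longrightarrow> slot_level s \<le> top_level Q"
  by (simp add: top_level_def)

lemma top_level_attained:
  assumes "0 < top_level Q"
  obtains s where "s \<in># Q" "slot_level s = top_level Q"
proof -
  have "top_level Q \<in> insert 0 (slot_level ` set_mset Q)"
    unfolding top_level_def by (intro Max_in) auto
  then show ?thesis using assms that by auto
qed

text \<open>The algorithm as seen by the regions of the colour of the arriving item. A new region
  below level \<open>j\<close> may lie in an existing bin and inherits its status \<open>cl\<close>;
  at level \<open>j\<close> it is a fresh open bin.\<close>

inductive colour_step :: "nat \<Rightarrow> slot multiset \<Rightarrow> item \<Rightarrow> slot multiset \<Rightarrow> bool" for j where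
  fit: "\<lbrakk>top_level (add_mset s Q) < j; slot_level s = top_level (add_mset s Q);
      slot_load s + sz e \<le> region_size j (slot_level s)\<rbrakk>
    \<Longrightarrow> colour_step j (add_mset s Q) e (add_mset (fill e s) Q)"
| new_region: "\<lbrakk>top_level Q < j;
      \<And>s. s \<in># Q \<Longrightarrow> slot_level s = top_level Q \<Longrightarrow> region_size j (top_level Q) < slot_load s + sz e;
      top_level Q < l; l \<le> j; sz e \<le> region_size j l;
      \<And>l'. top_level Q < l' \<Longrightarrow> l' < l \<Longrightarrow> region_size j l' < sz e;
      l = j \<longrightarrow> \<not> cl\<rbrakk>
    \<Longrightarrow> colour_step j Q e (add_mset (Slot l cl {#e#}) Q)"
| best_fit: "\<lbrakk>j \<le> top_level (add_mset s Q); slot_level s = j; \<not> slot_closed s;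
      slot_load s + sz e \<le> 1;
      \<And>t. t \<in># open_slots j Q \<Longrightarrow> slot_load t + sz e \<le> 1 \<Longrightarrow> slot_load t \<le> slot_load s\<rbrakk>
    \<Longrightarrow> colour_step j (add_mset s Q) e (add_mset (fill e s) Q)"
| open_new: "\<lbrakk>j \<le> top_level Q; \<And>s. s \<in># open_slots j Q \<Longrightarrow> 1 < slot_load s + sz e;
      size (open_slots j Q) < 2\<rbrakk>
    \<Longrightarrow> colour_step j Q e (add_mset (Slot j False {#e#}) Q)"
| close: "\<lbrakk>j \<le> top_level (add_mset s Q); slot_level s = j; \<not> slot_closed s;
      open_slots j Q \<noteq> {#};
      \<And>t. t \<in># open_slots j Q \<Longrightarrow> slot_load t \<le> slot_load s \<and> 1 < slot_load t + sz e\<rbrakk>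
    \<Longrightarrow> colour_step j (add_mset s Q) e
          (add_mset (Slot j False {#e#}) (add_mset (Slot j True (slot_items s)) Q))"

text \<open>The account \<open>T\<close>, taken over the isolated bins of one colour. Items in open
  bins already contribute their bonus.\<close>

definition slot_surplus :: "nat \<Rightarrow> slot multiset \<Rightarrow> real" where
  "slot_surplus j Q = (\<Sum>s\<in>#at_level j Q. total_bonus (slot_items s)) -
     (\<Sum>s\<in>#closed_slots j Q. 1 - 6/5 * slot_load s)"

text \<open>A bin is closed only when another open bin remains, and a new one opens at once; hence
  closed bins imply two open ones.\<close>

definition isolated_inv :: "nat \<Rightarrow> slot multiset \<Rightarrow> bool" where
  "isolated_inv j Q \<longleftrightarrow> (\<forall>s\<in>#closed_slots j Q. 1/2 < slot_load s) \<and>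
     (size (open_slots j Q) < 2 \<longrightarrow> closed_slots j Q = {#}) \<and>
     bbf_inv (image_mset slot_load (open_slots j Q)) (slot_surplus j Q)"

lemma at_level_above_top: "top_level Q < j \<Longrightarrow> at_level j Q = {#}"
  by (auto simp: at_level_empty_iff dest: slot_level_le_top)

lemma isolated_inv_no_slots:
  assumes "at_level j Q = {#}"
  shows "isolated_inv j Q"
  using assms
  by (simp add: isolated_inv_def slot_surplus_def bbf_inv_def at_level_eq_open_closed)

text \<open>Before level \<open>j\<close> is reached there is no isolated bin, and a Modified Next
  Fit step creates at most the first one. The Bounded Best-Fit steps are the three lemmas on
  \<open>bbf_inv\<close>.\<close>

lemma isolated_inv_step:
  assumes "colour_step j Q e Q'" "isolated_inv j Q" "0 \<le> sz e"
  shows "isolated_inv j Q'"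
  using assms
proof (induction rule: colour_step.induct)
  case (fit s Q e)
  from fit(1) have "at_level j (add_mset s Q) = {#}" by (rule at_level_above_top)
  then show ?case by (intro isolated_inv_no_slots) (auto split: if_splits)
next
  case (new_region Q e l cl)
  from new_region(1) have Q: "at_level j Q = {#}" by (rule at_level_above_top)
  show ?case
  proof (cases "l = j")
    case False
    with Q show ?thesis by (intro isolated_inv_no_slots) auto
  next
    case True
    with Q new_region(7) show ?thesis
      by (simp add: isolated_inv_def slot_surplus_def bbf_inv_def at_level_eq_open_closed
          bonus_nonneg)
  qed
next
  case (best_fit s Q e)
  let ?L = "image_mset slot_load (open_slots j Q)"
  have "bbf_inv (add_mset (slot_load s) ?L) (slot_surplus j (add_mset s Q))"
    using best_fit by (simp add: isolated_inv_def)
  then have "bbf_inv (add_mset (slot_load s + sz e) ?L)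
      (slot_surplus j (add_mset s Q) + bonus (sz e))"
    by (rule bbf_inv_fit) (use best_fit in auto)
  then show ?case
    using best_fit by (auto simp: isolated_inv_def slot_surplus_def algebra_simps)
next
  case (open_new Q e)
  let ?L = "image_mset slot_load (open_slots j Q)"
  have "bbf_inv (add_mset (sz e) ?L) (slot_surplus j Q + bonus (sz e))"
    by (rule bbf_inv_open) (use open_new in \<open>auto simp: isolated_inv_def\<close>)
  then show ?case
    using open_new by (auto simp: isolated_inv_def slot_surplus_def algebra_simps)
next
  case (close s Q e)
  let ?L = "image_mset slot_load (open_slots j Q)"
  have inv: "bbf_inv (add_mset (slot_load s) ?L) (slot_surplus j (add_mset s Q))"
    using close by (simp add: isolated_inv_def)
  have "bbf_inv (add_mset (sz e) ?L)
      (slot_surplus j (add_mset s Q) + bonus (sz e) - (1 - 6/5 * slot_load s))"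
    and "1/2 < slot_load s"
    by (rule bbf_inv_close[OF inv]; use close in auto)+
  moreover have "slot_surplus j (add_mset (Slot j False {#e#})
      (add_mset (Slot j True (slot_items s)) Q)) =
      slot_surplus j (add_mset s Q) + bonus (sz e) - (1 - 6/5 * slot_load s)"
    using close(2,3) by (simp add: slot_surplus_def)
  \<comment> \<open>The bin left open and the new bin make two, so the clause on fewer than two open
    bins holds vacuously.\<close>
  moreover have "\<not> size (open_slots j Q) < 1"
    using close(4) by (simp add: less_Suc_eq)
  ultimately show ?case
    using close by (auto simp: isolated_inv_def)
qed

section \<open>Levels of one colour under Modified Next Fit\<close>

definition level_load :: "nat \<Rightarrow> slot multiset \<Rightarrow> real" where
  "level_load l Q = (\<Sum>s\<in>#at_level l Q. slot_load s)"

lemma level_load_simps [simp]: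
  "level_load l {#} = 0"
  "level_load l (add_mset s Q) = (if slot_level s = l then slot_load s else 0) + level_load l Q"
  by (simp_all add: level_load_def)

definition items_inv :: "nat \<Rightarrow> slot multiset \<Rightarrow> bool" where
  "items_inv j Q \<longleftrightarrow> (\<forall>s\<in>#Q. 1 \<le> slot_level s \<and> slot_level s \<le> j \<and>
     slot_load s \<le> region_size j (slot_level s) \<and> (\<forall>e\<in>#slot_items s. 0 \<le> sz e))"

text \<open>Uniqueness stops below \<open>j\<close>, since a colour may have many isolated bins. At
  l = 1 the second clause compares with \<open>region_size j 0\<close>, which is
  \<open>eps j\<close>; level 0 itself is excluded by \<open>items_inv\<close>.\<close>

definition mnf_inv :: "nat \<Rightarrow> slot multiset \<Rightarrow> bool" where
  "mnf_inv j Q \<longleftrightarrow> (\<forall>l<j. size (at_level l Q) \<le> 1) \<and>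
     (\<forall>l. at_level l Q \<noteq> {#} \<longrightarrow>
        region_size j (l - 1) \<le> level_load (l - 1) Q + level_load l Q)"

lemma region_size_Suc: "region_size j (Suc l) = 2 * region_size j l"
  and region_size_top [simp]: "region_size j j = 1"
  and region_size_0: "region_size j 0 = eps j"
  and region_size_pos: "0 < region_size j l"
  by (simp_all add: region_size_def eps_def)

lemma items_inv_step:
  assumes "colour_step j Q e Q'" "items_inv j Q" "0 \<le> sz e" "sz e \<le> 1" "1 \<le> j"
  shows "items_inv j Q'"
  using assms
  by (induction rule: colour_step.induct) (auto simp: items_inv_def algebra_simps)

lemma items_inv_slot_load_nonneg: "items_inv j Q \<Longrightarrow> s \<in># Q \<Longrightarrow> 0 \<le> slot_load s"
  by (auto simp: items_inv_def intro: load_nonneg)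

lemma level_load_nonneg:
  assumes "items_inv j Q"
  shows "0 \<le> level_load l Q"
  using assms
proof (induction Q)
  case (add s Q)
  then have "0 \<le> slot_load s" "items_inv j Q"
    using items_inv_slot_load_nonneg[of j "add_mset s Q" s] by (auto simp: items_inv_def)
  then show ?case using add.IH by simp
qed simp

text \<open>For the steps that bring no new level into use: loads only grow and the set of used
  levels stays the same.\<close>

lemma mnf_inv_mono:
  assumes "mnf_inv j Q" "\<And>l. l < j \<Longrightarrow> size (at_level l Q') = size (at_level l Q)"
    "at_level j Q' = {#} \<longleftrightarrow> at_level j Q = {#}"
    "\<And>l. j < l \<Longrightarrow> at_level l Q' = {#}"
    "\<And>l. level_load l Q \<le> level_load l Q'"
  shows "mnf_inv j Q'"
proof -
  have "region_size j (l - 1) \<le> level_load (l - 1) Q' + level_load l Q'"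
    if "at_level l Q' \<noteq> {#}" for l
  proof -
    have "l \<le> j" using assms(4) that by (metis not_less)
    then have "at_level l Q \<noteq> {#}"
      using that assms(2)[of l] assms(3) by (cases "l = j") auto
    then have "region_size j (l - 1) \<le> level_load (l - 1) Q + level_load l Q"
      using assms(1) by (simp add: mnf_inv_def)
    then show ?thesis using assms(5)[of l] assms(5)[of "l - 1"] by linarith
  qed
  then show ?thesis using assms(1,2) by (simp add: mnf_inv_def)
qed

text \<open>Only \<open>new_region\<close> brings a level l into use. The level l - 1 is either 0,
  of region size at most that of any item; or the previous top level, whose region had no room for
  the item; or a skipped level, whose regions are smaller than the item.\<close>

lemma mnf_inv_step:
  assumes "colour_step j Q e Q'" "mnf_inv j Q" "items_inv j Q" "eps j \<le> sz e" "1 \<le> j"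
  shows "mnf_inv j Q'"
  using assms
proof (induction rule: colour_step.induct)
  case (fit s Q e)
  have "0 \<le> sz e" using fit.prems(3) region_size_pos[of j 0] by (simp add: region_size_0)
  have "at_level l Q = {#}" if "j < l" for l
    using fit.prems(2) that by (auto simp: items_inv_def at_level_empty_iff)
  then show ?case using fit \<open>0 \<le> sz e\<close>
    by (intro mnf_inv_mono[OF fit.prems(1)]) (auto split: if_splits)
next
  case (new_region Q e l cl)
  let ?Q' = "add_mset (Slot l cl {#e#}) Q"
  have e0: "0 \<le> sz e" using new_region.prems(3) region_size_pos[of j 0] by (simp add: region_size_0)
  have "at_level l Q = {#}" using new_region(3) by (rule at_level_above_top)
  moreover have "region_size j (l' - 1) \<le> level_load (l' - 1) ?Q' + level_load l' ?Q'"
    if "at_level l' ?Q' \<noteq> {#}" for l'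
  proof (cases "l' = l")
    case False
    then have "region_size j (l' - 1) \<le> level_load (l' - 1) Q + level_load l' Q"
      using that new_region.prems(1) by (auto simp: mnf_inv_def)
    then show ?thesis using e0 by auto
  next
    case True
    have nn: "0 \<le> level_load (l - 1) Q" "0 \<le> level_load l Q"
      using level_load_nonneg new_region.prems(2) by blast+
    consider "l - 1 = 0" | "0 < l - 1" "l - 1 = top_level Q" | "top_level Q < l - 1" "0 < l - 1"
      using new_region(3) by linarith
    then show ?thesis
    proof cases
      case 1
      then show ?thesis using True nn e0 new_region.prems(3) by (auto simp: region_size_0)
    next
      case 2
      then obtain s where s: "s \<in># Q" "slot_level s = l - 1"
        using top_level_attained[of Q] by metis
      then have "region_size j (l - 1) < slot_load s + sz e" using new_region(2) 2 by simp
      moreover have "slot_load s \<le> level_load (l - 1) Q"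
      proof -
        obtain N where N: "Q = add_mset s N" using s(1) by (meson multi_member_split)
        then have "items_inv j N" using new_region.prems(2) by (simp add: items_inv_def)
        then show ?thesis using N s(2) level_load_nonneg by simp
      qed
      ultimately show ?thesis using True nn new_region(3) by auto
    next
      case 3
      then have "region_size j (l - 1) < sz e" by (intro new_region(6)) auto
      then show ?thesis using True nn new_region(3) by auto
    qed
  qed
  ultimately show ?case using new_region.prems(1) by (auto simp: mnf_inv_def)
next
  case (best_fit s Q e)
  have "0 \<le> sz e" using best_fit.prems(3) region_size_pos[of j 0] by (simp add: region_size_0)
  have "at_level l Q = {#}" if "j < l" for l
    using best_fit.prems(2) that by (auto simp: items_inv_def at_level_empty_iff)
  then show ?case using best_fit \<open>0 \<le> sz e\<close>
    by (intro mnf_inv_mono[OF best_fit.prems(1)]) auto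
next
  case (open_new Q e)
  have "0 \<le> sz e" using open_new.prems(3) region_size_pos[of j 0] by (simp add: region_size_0)
  have "at_level l Q = {#}" if "j < l" for l
    using open_new.prems(2) that by (auto simp: items_inv_def at_level_empty_iff)
  \<comment> \<open>The top level is at least \<open>j\<close>, and positive, hence attained; so the
    new bin does not bring level \<open>j\<close> into use for the first time.\<close>
  moreover have "at_level j Q \<noteq> {#}"
  proof -
    obtain s where s: "s \<in># Q" "slot_level s = top_level Q"
      using top_level_attained[of Q] open_new(1) open_new.prems(4) by auto
    then have "slot_level s = j"
      using open_new(1) open_new.prems(2) by (auto simp: items_inv_def)
    then show ?thesis using s by (auto simp: at_level_empty_iff)
  qed
  ultimately show ?case using open_new \<open>0 \<le> sz e\<close>
    by (intro mnf_inv_mono[OF open_new.prems(1)]) auto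
next
  case (close s Q e)
  have "0 \<le> sz e" using close.prems(3) region_size_pos[of j 0] by (simp add: region_size_0)
  have "at_level l Q = {#}" if "j < l" for l
    using close.prems(2) that by (auto simp: items_inv_def at_level_empty_iff)
  then show ?case using close \<open>0 \<le> sz e\<close>
    by (intro mnf_inv_mono[OF close.prems(1)]) auto
qed

definition colour_inv :: "nat \<Rightarrow> slot multiset \<Rightarrow> bool" where
  "colour_inv j Q \<longleftrightarrow> items_inv j Q \<and> mnf_inv j Q \<and> isolated_inv j Q"

lemma colour_inv_empty: "colour_inv j {#}"
  by (simp add: colour_inv_def items_inv_def mnf_inv_def isolated_inv_no_slots)

lemma colour_inv_step:
  assumes "colour_step j Q e Q'" "colour_inv j Q" "eps j \<le> sz e" "sz e \<le> 1" "1 \<le> j"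
  shows "colour_inv j Q'"
proof -
  have "0 \<le> sz e" using assms(3) region_size_pos[of j 0] by (simp add: region_size_0)
  then show ?thesis
    using assms items_inv_step mnf_inv_step isolated_inv_step unfolding colour_inv_def by blast
qed

section \<open>Region sizes and number of regions of one colour\<close>

lemma sum_mset_by_level:
  fixes f :: "slot \<Rightarrow> real"
  assumes "\<And>s. s \<in># Q \<Longrightarrow> slot_level s \<le> n"
  shows "(\<Sum>s\<in>#Q. f s) = (\<Sum>l\<le>n. \<Sum>s\<in>#at_level l Q. f s)"
  using assms
proof (induction Q)
  case (add s Q)
  have "(\<Sum>l\<le>n. \<Sum>t\<in>#at_level l (add_mset s Q). f t) =
      (\<Sum>l\<le>n. (if slot_level s = l then f s else 0) + (\<Sum>t\<in>#at_level l Q. f t))"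
    by (intro sum.cong) auto
  also have "\<dots> = f s + (\<Sum>l\<le>n. \<Sum>t\<in>#at_level l Q. f t)"
    using add.prems[of s] by (simp add: sum.distrib)
  finally show ?case using add by simp
qed simp

text \<open>An empty top level is dropped. A used level n is paired with n - 1: their region sizes
  add up to at most three times \<open>region_size j (n - 1)\<close>, which the loads of these two
  levels cover. The induction then continues at n - 2.\<close>

lemma region_sizes_le_prefix:
  assumes "items_inv j Q" "mnf_inv j Q" "\<And>l. l \<le> n \<Longrightarrow> size (at_level l Q) \<le> 1"
  shows "(\<Sum>l\<le>n. size (at_level l Q) * region_size j l) \<le> 3 * (\<Sum>l\<le>n. level_load l Q)"
  using assms(3)
proof (induction n rule: less_induct)
  case (less n)
  have lv0: "at_level 0 Q = {#}"
    using assms(1) by (auto simp: items_inv_def at_level_empty_iff)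
  then have ll0: "level_load 0 Q = 0" by (simp add: level_load_def)
  have nn: "0 \<le> level_load l Q" for l using level_load_nonneg assms(1) by blast
  show ?case
  proof (cases n)
    case 0
    then show ?thesis using lv0 ll0 by simp
  next
    case (Suc k)
    note IHk = less.IH[of k]
    show ?thesis
    proof (cases "at_level n Q = {#}")
      case True
      then show ?thesis using IHk Suc less.prems nn[of n] by simp
    next
      case False
      then have sz: "size (at_level n Q) = 1"
        using less.prems[of n] by (metis le_refl le_neq_implies_less less_one size_eq_0_iff_empty)
      have key: "region_size j k \<le> level_load k Q + level_load n Q"
        using assms(2) False Suc unfolding mnf_inv_def by force
      show ?thesis
      proof (cases k)
        case 0
        then show ?thesis using sz key Suc lv0 ll0 region_size_Suc[of j 0] nn[of n] by simp
      next
        case (Suc i)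
        \<comment> \<open>Level \<open>k\<close> may have been skipped; the bound holds in both
          cases.\<close>
        have "size (at_level k Q) * region_size j k \<le> region_size j k"
          using less.prems[of k] \<open>n = Suc k\<close> region_size_pos[of j k]
          by (simp add: mult_left_le_one_le)
        moreover have "region_size j n = 2 * region_size j k"
          using \<open>n = Suc k\<close> by (simp add: region_size_Suc)
        moreover have "(\<Sum>l\<le>i. size (at_level l Q) * region_size j l)
            \<le> 3 * (\<Sum>l\<le>i. level_load l Q)"
          using less \<open>n = Suc k\<close> Suc by simp
        moreover have "{..n} = insert n (insert k {..i})" using \<open>n = Suc k\<close> Suc by auto
        ultimately show ?thesis using key sz \<open>n = Suc k\<close> Suc by simp
      qed
    qed
  qed
qed

text \<open>Two isolated bins force exactly two open ones, whose loads sum to more than 1, and every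
  closed bin is more than half full.\<close>

lemma isolated_load_ge:
  assumes "isolated_inv j Q" "2 \<le> size (at_level j Q)"
  shows "size (at_level j Q) / 2 \<le> level_load j Q"
proof -
  have "\<not> size (open_slots j Q) < 2"
    using assms by (auto simp: isolated_inv_def at_level_eq_open_closed)
  moreover have "size (image_mset slot_load (open_slots j Q)) \<le> 2"
    using assms bbf_inv_sizeD unfolding isolated_inv_def by blast
  ultimately have size: "size (open_slots j Q) = 2" by simp
  have "image_mset slot_load (open_slots j Q) \<noteq> {#}"
    "\<And>x. image_mset slot_load (open_slots j Q) \<noteq> {#x#}"
    using size by (metis size_image_mset size_empty zero_neq_numeral,
        metis size_image_mset size_single numeral_eq_one_iff semiring_norm(85))
  then obtain x y where xy: "image_mset slot_load (open_slots j Q) = {#x, y#}" "1 < x + y"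
    using assms(1) unfolding isolated_inv_def bbf_inv_def by blast
  have "size C / 2 \<le> (\<Sum>s\<in>#C. slot_load s)" if "\<forall>s\<in>#C. 1/2 < slot_load s" for C
    using that by (induction C) auto
  then have "size (closed_slots j Q) / 2 \<le> (\<Sum>s\<in>#closed_slots j Q. slot_load s)"
    using assms(1) by (simp add: isolated_inv_def)
  then show ?thesis
    using xy size by (simp add: level_load_def at_level_eq_open_closed)
qed

lemma colour_region_sizes_le:
  assumes "colour_inv j Q" "1 \<le> j"
  shows "(\<Sum>s\<in>#Q. region_size j (slot_level s)) \<le> 3 * (\<Sum>s\<in>#Q. slot_load s)"
proof -
  have inv: "items_inv j Q" "mnf_inv j Q" "isolated_inv j Q"
    using assms by (auto simp: colour_inv_def)
  have le: "slot_level s \<le> j" if "s \<in># Q" for s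
    using inv(1) that by (auto simp: items_inv_def)
  have const: "(\<Sum>s\<in>#at_level l Q. region_size j (slot_level s)) =
      size (at_level l Q) * region_size j l" for l
    by (induction Q) (auto simp: algebra_simps)
  have "(\<Sum>l\<le>j. size (at_level l Q) * region_size j l) \<le> 3 * (\<Sum>l\<le>j. level_load l Q)"
  proof (cases "size (at_level j Q) \<le> 1")
    case True
    then show ?thesis using inv(1,2)
      by (intro region_sizes_le_prefix) (auto simp: mnf_inv_def le_less)
  next
    case False
    obtain k where k: "j = Suc k" using assms(2) by (cases j) auto
    \<comment> \<open>With several isolated bins the pairing starts at level j - 1, and the isolated
      bins pay for themselves, being half full on average.\<close>
    have "(\<Sum>l\<le>k. size (at_level l Q) * region_size j l) \<le> 3 * (\<Sum>l\<le>k. level_load l Q)"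
      using inv(1,2) k by (intro region_sizes_le_prefix) (auto simp: mnf_inv_def)
    moreover have "size (at_level j Q) * region_size j j \<le> 3 * level_load j Q"
      using isolated_load_ge[OF inv(3)] False by simp
    ultimately show ?thesis unfolding k by simp
  qed
  moreover have "(\<Sum>s\<in>#Q. region_size j (slot_level s)) =
      (\<Sum>l\<le>j. size (at_level l Q) * region_size j l)"
    using sum_mset_by_level[of Q j "\<lambda>s. region_size j (slot_level s)"] le const by simp
  moreover have "(\<Sum>s\<in>#Q. slot_load s) = (\<Sum>l\<le>j. level_load l Q)"
    using sum_mset_by_level[of Q j slot_load] le by (simp add: level_load_def)
  ultimately show ?thesis by simp
qed

text \<open>A closed bin contributes its weight minus 1 to the account, so the account is at most
  the total weight minus the number of closed bins. The constant is 3/10 for the lowest account plus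
  2 for the open bins.\<close>

lemma isolated_count_le:
  assumes "colour_inv j Q"
  shows "size (at_level j Q) \<le> (\<Sum>s\<in>#Q. total_weight (slot_items s)) + 23/10"
proof -
  have inv: "items_inv j Q" "isolated_inv j Q"
    using assms by (auto simp: colour_inv_def)
  have "size (open_slots j Q) \<le> 2" "- 3/10 \<le> slot_surplus j Q"
    using inv(2) bbf_inv_sizeD unfolding isolated_inv_def by fastforce+
  moreover have "slot_surplus j Q \<le> (\<Sum>s\<in>#Q. total_weight (slot_items s)) - size (closed_slots j Q)"
    using inv(1)
  proof (induction Q)
    case (add s Q)
    have "0 \<le> slot_load s" using items_inv_slot_load_nonneg[OF add.prems, of s] by simp
    moreover have "0 \<le> total_weight (slot_items s)"
      using add.prems by (intro total_weight_nonneg) (auto simp: items_inv_def)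
    moreover have "items_inv j Q" using add.prems by (simp add: items_inv_def)
    ultimately show ?case using add.IH
      by (auto simp: slot_surplus_def total_weight_eq)
  qed (simp add: slot_surplus_def)
  ultimately show ?thesis by (simp add: at_level_eq_open_closed)
qed

lemma lower_count_le:
  assumes "colour_inv j Q" "1 \<le> j"
  shows "size (filter_mset (\<lambda>s. slot_level s \<noteq> j) Q) \<le> j - 1"
proof -
  have inv: "items_inv j Q" "mnf_inv j Q" using assms by (auto simp: colour_inv_def)
  have "size (filter_mset (\<lambda>s. slot_level s \<noteq> j) Q) = (\<Sum>l\<in>{1..<j}. size (at_level l Q))"
    using inv(1)
  proof (induction Q)
    case (add s Q)
    have *: "size (at_level l (add_mset s Q)) =
        (if slot_level s = l then 1 else 0) + size (at_level l Q)" for l by simp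
    show ?case using add unfolding *
      by (auto simp: items_inv_def sum.distrib)
  qed simp
  also have "\<dots> \<le> (\<Sum>l\<in>{1..<j}. 1)"
    using inv(2) by (intro sum_mono) (auto simp: mnf_inv_def)
  finally show ?thesis by simp
qed

lemma colour_count_le:
  assumes "colour_inv j Q" "1 \<le> j"
  shows "size Q \<le> (\<Sum>s\<in>#Q. total_weight (slot_items s)) + j + 13/10"
proof -
  have "size Q = size (at_level j Q) + size (filter_mset (\<lambda>s. slot_level s \<noteq> j) Q)"
    unfolding at_level_def by (metis multiset_partition size_union)
  then show ?thesis
    using isolated_count_le[OF assms(1)] lower_count_le[OF assms] assms(2) by linarith
qed

lemma colour_open_count_le:
  assumes "colour_inv j Q" "1 \<le> j"
  shows "size (filter_mset (\<lambda>s. \<not> slot_closed s) Q) \<le> j + 1"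
proof -
  have "size (filter_mset (\<lambda>s. \<not> slot_closed s) Q) \<le>
      size (open_slots j Q) + size (filter_mset (\<lambda>s. slot_level s \<noteq> j) Q)"
    by (induction Q) auto
  moreover have "size (open_slots j Q) \<le> 2"
    using assms(1) bbf_inv_sizeD unfolding colour_inv_def isolated_inv_def by fastforce
  ultimately show ?thesis using lower_count_le[OF assms] assms(2) by linarith
qed

section \<open>From bins to slots\<close>

lemma has_colour_simps [simp]:
  "\<not> has_colour c {#}"
  "has_colour c (add_mset e X) \<longleftrightarrow> col e = c \<or> has_colour c X"
  "has_colour c (X + Y) \<longleftrightarrow> has_colour c X \<or> has_colour c Y"
  by (auto simp: has_colour_def)

lemma has_colour_contents: "has_colour c (contents b) \<longleftrightarrow> (\<exists>X\<in>set (regions b). has_colour c X)"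
proof -
  have "has_colour c (sum_list Xs) \<longleftrightarrow> (\<exists>X\<in>set Xs. has_colour c X)" for Xs
    by (induction Xs) auto
  then show ?thesis by (simp add: contents_def)
qed

definition bin_slots :: "bin \<Rightarrow> slot multiset" where
  "bin_slots b = image_mset (Slot (level b) (closed b)) (mset (regions b))"

text \<open>A slot is a region together with the level and status of its bin; which regions share a bin
  matters only for the number of bins, which the region sizes determine.\<close>

definition slots :: "bin list \<Rightarrow> slot multiset" where
  "slots B = (\<Sum>b\<leftarrow>B. bin_slots b)"

definition of_colour :: "nat \<Rightarrow> slot multiset \<Rightarrow> slot multiset" where
  "of_colour c M = filter_mset (\<lambda>s. has_colour c (slot_items s)) M"

lemma slots_simps [simp]:
  "slots [] = {#}"
  "slots (b # B) = bin_slots b + slots B"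
  "slots (A @ B) = slots A + slots B"
  by (simp_all add: slots_def)

lemma of_colour_simps [simp]:
  "of_colour c {#} = {#}"
  "of_colour c (add_mset s M) =
     (if has_colour c (slot_items s) then add_mset s (of_colour c M) else of_colour c M)"
  "of_colour c (M + N) = of_colour c M + of_colour c N"
  by (simp_all add: of_colour_def)

lemma in_of_colour [simp]: "s \<in># of_colour c M \<longleftrightarrow> s \<in># M \<and> has_colour c (slot_items s)"
  by (simp add: of_colour_def)

lemma in_slots: "s \<in># slots B \<longleftrightarrow>
    (\<exists>k r. k < length B \<and> r < length (regions (B ! k)) \<and>
       s = Slot (level (B ! k)) (closed (B ! k)) (regions (B ! k) ! r))"
proof -
  have "s \<in># slots B \<longleftrightarrow> (\<exists>b\<in>set B. \<exists>X\<in>set (regions b). s = Slot (level b) (closed b) X)"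
    by (induction B) (auto simp: bin_slots_def)
  also have "\<dots> \<longleftrightarrow> (\<exists>k r. k < length B \<and> r < length (regions (B ! k)) \<and>
       s = Slot (level (B ! k)) (closed (B ! k)) (regions (B ! k) ! r))"
    by (metis in_set_conv_nth)
  finally show ?thesis .
qed

text \<open>Stated additively, so that no multiset difference occurs.\<close>

lemma slots_list_update:
  "k < length B \<Longrightarrow> slots (B[k := b]) + bin_slots (B ! k) = slots B + bin_slots b"
proof (induction B arbitrary: k)
  case (Cons a B)
  show ?case
  proof (cases k)
    case (Suc i)
    then have "slots (B[i := b]) + bin_slots (B ! i) = slots B + bin_slots b" using Cons by simp
    then show ?thesis using Suc by (simp add: add.assoc)
  qed (simp add: ac_simps)
qed simp

lemma slots_put:
  assumes "k < length B" "r < length (regions (B ! k))"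
    and s: "s = Slot (level (B ! k)) (closed (B ! k)) (regions (B ! k) ! r)"
  obtains N where "slots B = add_mset s N" "slots (put e k r B) = add_mset (fill e s) N"
proof -
  let ?b = "B ! k"
  let ?X = "regions ?b ! r"
  let ?b' = "?b\<lparr>regions := (regions ?b)[r := add_mset e ?X]\<rparr>"
  let ?M = "image_mset (Slot (level ?b) (closed ?b)) (mset (regions ?b) - {#?X#})"
  have "bin_slots ?b = add_mset s ?M"
    using assms(2) unfolding bin_slots_def s
    by (metis image_mset_add_mset insert_DiffM nth_mem_mset)
  moreover have "bin_slots ?b' = add_mset (fill e s) ?M"
    using assms(2) unfolding bin_slots_def s by (simp add: mset_update fill_def)
  moreover have "slots (put e k r B) + bin_slots ?b = slots B + bin_slots ?b'"
    unfolding put_def using assms(1) by (rule slots_list_update)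
  ultimately have eq: "add_mset s (slots (put e k r B)) = add_mset (fill e s) (slots B)"
    by simp
  have "s \<in># slots B" using assms by (auto simp: in_slots)
  then obtain N where N: "slots B = add_mset s N" by (meson multi_member_split)
  then have "slots (put e k r B) = add_mset (fill e s) N" using eq by (simp add: add_mset_commute)
  with N show ?thesis by (rule that)
qed

lemma slots_put_new:
  "slots (put_new j e l B) =
     add_mset (Slot l False {#e#}) (replicate_mset (2 ^ (j - l) - 1) (Slot l False {#}) + slots B)"
proof -
  obtain n where n: "(2::nat) ^ (j - l) = Suc n" by (metis not0_implies_Suc power_not_zero zero_neq_numeral)
  have "put_new j e l B = B @ [\<lparr>level = l, regions = {#e#} # replicate n {#}, closed = False\<rparr>]"
    by (simp add: put_new_def put_def new_bin_def n nth_append list_update_append)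
  then show ?thesis by (simp add: bin_slots_def n)
qed

lemma slots_close:
  assumes "k < length B" "regions (B ! k) = [X]" "s = Slot (level (B ! k)) (closed (B ! k)) X"
    "slots B = add_mset s N"
  shows "slots (close_bin k B) = add_mset (Slot (slot_level s) True (slot_items s)) N"
proof -
  have "slots (close_bin k B) + bin_slots (B ! k) =
      slots B + bin_slots ((B ! k)\<lparr>closed := True\<rparr>)"
    unfolding close_bin_def using assms(1) by (rule slots_list_update)
  then show ?thesis using assms by (simp add: bin_slots_def add_mset_commute)
qed

section \<open>Contents and shape of the bins\<close>

lemma contents_put:
  assumes "r < length (regions b)"
  shows "contents (b\<lparr>regions := (regions b)[r := add_mset e (regions b ! r)]\<rparr>) =
    add_mset e (contents b)"
proof -
  have "sum_list (Xs[r := add_mset e (Xs ! r)]) = add_mset e (sum_list Xs)"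
    if "r < length Xs" for Xs
    using that by (induction Xs arbitrary: r) (auto split: nat.split)
  then show ?thesis using assms by (simp add: contents_def)
qed

lemma all_contents_put:
  assumes "k < length B" "r < length (regions (B ! k))"
  shows "sum_list (map contents (put e k r B)) = add_mset e (sum_list (map contents B))"
  using assms
proof (induction B arbitrary: k)
  case (Cons b B)
  show ?case
  proof (cases k)
    case 0
    then show ?thesis using Cons by (simp add: put_def contents_put)
  next
    case (Suc i)
    then have "sum_list (map contents (put e i r B)) = add_mset e (sum_list (map contents B))"
      using Cons by simp
    then show ?thesis using Suc by (simp add: put_def)
  qed
qed simp

lemma put_new_eq:
  "put_new j e l B = B @ [(new_bin j l)\<lparr>regions := (regions (new_bin j l))[0 := {#e#}]\<rparr>]"
  by (simp add: put_new_def put_def new_bin_def list_update_append)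

lemma all_contents_put_new:
  "sum_list (map contents (put_new j e l B)) = add_mset e (sum_list (map contents B))"
proof -
  have "sum_list (replicate n {#}) = ({#} :: item multiset)" for n
    by (induction n) auto
  then have "contents (new_bin j l) = {#}" by (simp add: contents_def new_bin_def)
  moreover have "sum_list (map contents (put_new j e l B)) =
      add_mset e (sum_list (map contents (B @ [new_bin j l])))"
    unfolding put_new_def by (rule all_contents_put) (simp_all add: new_bin_def)
  ultimately show ?thesis by simp
qed

lemma all_contents_close:
  "k < length B \<Longrightarrow> map contents (close_bin k B) = map contents B"
  by (auto simp: close_bin_def map_update contents_def list_update_same_conv)

text \<open>The number of regions makes the region sizes of a bin add up to 1; nonempty contents let
  an open bin be charged to a colour.\<close>

definition bins_inv :: "nat \<Rightarrow> bin list \<Rightarrow> bool" where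
  "bins_inv j B \<longleftrightarrow> (\<forall>b\<in>set B. 1 \<le> level b \<and> level b \<le> j \<and>
     length (regions b) = 2 ^ (j - level b) \<and> contents b \<noteq> {#})"

lemma bins_inv_put:
  assumes "bins_inv j B" "k < length B" "r < length (regions (B ! k))"
  shows "bins_inv j (put e k r B)"
proof -
  have "B ! k \<in> set B" using assms(2) by simp
  then show ?thesis
    using assms contents_put[OF assms(3), of e]
    by (auto simp: bins_inv_def put_def dest!: set_update_subset_insert[THEN subsetD])
qed

lemma bins_inv_put_new:
  assumes "bins_inv j B" "1 \<le> l" "l \<le> j"
  shows "bins_inv j (put_new j e l B)"
proof -
  have "contents ((new_bin j l)\<lparr>regions := (regions (new_bin j l))[0 := {#e#}]\<rparr>) =
      add_mset e (contents (new_bin j l))"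
    using contents_put[of 0 "new_bin j l" e] by (simp add: new_bin_def)
  then show ?thesis
    using assms by (auto simp: bins_inv_def put_new_eq new_bin_def)
qed

lemma bins_inv_close:
  assumes "bins_inv j B" "k < length B"
  shows "bins_inv j (close_bin k B)"
proof -
  have "B ! k \<in> set B" using assms(2) by simp
  then show ?thesis
    using assms
    by (auto simp: bins_inv_def close_bin_def contents_def
        dest!: set_update_subset_insert[THEN subsetD])
qed

lemma bins_inv_top_bin:
  assumes "bins_inv j B" "b \<in> set B" "level b = j"
  shows "regions b = [contents b]"
proof -
  have "length (regions b) = 1" using assms by (simp add: bins_inv_def)
  then obtain X where "regions b = [X]" by (auto simp: length_Suc_conv)
  then show ?thesis by (simp add: contents_def)
qed

lemma top_level_of_colour: "top_level (of_colour c (slots B)) = colour_level B c"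
proof -
  have "slot_level ` set_mset (of_colour c (slots B)) =
      level ` {b \<in> set B. has_colour c (contents b)}"
    by (force simp: in_slots has_colour_contents in_set_conv_nth image_iff)
  then show ?thesis by (simp add: top_level_def colour_level_def)
qed

text \<open>A level-\<open>j\<close> bin has a single region, so such bins and their slots
  correspond one to one.\<close>

lemma card_open_isolated:
  assumes "bins_inv j B"
  shows "card (open_isolated j B c) = size (open_slots j (of_colour c (slots B)))"
proof -
  let ?P = "\<lambda>b. level b = j \<and> \<not> closed b \<and> has_colour c (contents b)"
  have "card (open_isolated j B c) = length (filter ?P B)"
    by (simp add: open_isolated_def length_filter_conv_card)
  also have "\<dots> = size (open_slots j (of_colour c (slots B)))"
    using assms
  proof (induction B)
    case (Cons b B)
    have "open_slots j (of_colour c (bin_slots b)) =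
        (if ?P b then {#Slot j False (contents b)#} else {#})"
    proof (cases "level b = j")
      case True
      then show ?thesis using bins_inv_top_bin[OF Cons.prems, of b] by (simp add: bin_slots_def)
    qed (auto simp: bin_slots_def open_slots_def)
    moreover have "bins_inv j B" using Cons.prems by (simp add: bins_inv_def)
    ultimately show ?case using Cons.IH by (simp add: open_slots_def)
  qed simp
  finally show ?thesis .
qed

lemma open_isolated_slot:
  assumes "bins_inv j B" "k \<in> open_isolated j B c"
  shows "k < length B" "regions (B ! k) = [contents (B ! k)]" "level (B ! k) = j"
    "\<not> closed (B ! k)" "has_colour c (contents (B ! k))"
  using assms bins_inv_top_bin[OF assms(1), of "B ! k"] by (auto simp: open_isolated_def)

lemma in_open_slots:
  assumes "bins_inv j B" "s \<in># open_slots j (of_colour c (slots B))"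
  obtains k where "k \<in> open_isolated j B c" "slot_items s = contents (B ! k)"
proof -
  obtain k r where k: "k < length B" "r < length (regions (B ! k))"
      "s = Slot (level (B ! k)) (closed (B ! k)) (regions (B ! k) ! r)"
      "level (B ! k) = j" "\<not> closed (B ! k)" "has_colour c (slot_items s)"
    using assms(2) by (auto simp: open_slots_def in_slots)
  moreover have reg: "regions (B ! k) = [contents (B ! k)]"
    using bins_inv_top_bin[OF assms(1)] k by simp
  then have "slot_items s = contents (B ! k)" using k by simp
  ultimately show ?thesis using that[of k] by (simp add: open_isolated_def)
qed

definition monochromatic :: "slot multiset \<Rightarrow> bool" where
  "monochromatic M \<longleftrightarrow> (\<forall>s\<in>#M. \<exists>c. \<forall>e\<in>#slot_items s. col e = c)"

lemma monochromaticD: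
  assumes "monochromatic M" "s \<in># M" "has_colour c (slot_items s)" "e \<in># slot_items s"
  shows "col e = c"
  using assms unfolding monochromatic_def has_colour_def by metis

definition unused_slots :: "nat \<Rightarrow> slot multiset \<Rightarrow> slot multiset" where
  "unused_slots l M = filter_mset (\<lambda>s. slot_level s = l \<and> slot_items s = {#}) M"

lemma unused_slots_empty_iff:
  "unused_slots l M = {#} \<longleftrightarrow> (\<forall>s\<in>#M. slot_level s = l \<longrightarrow> slot_items s \<noteq> {#})"
  by (induction M) (auto simp: unused_slots_def)

definition slots_inv :: "nat \<Rightarrow> slot multiset \<Rightarrow> bool" where
  "slots_inv j M \<longleftrightarrow> monochromatic M \<and> (\<forall>l. size (unused_slots l M) < 2 ^ (j - l))"

lemma slots_inv_fill:
  assumes "slots_inv j (add_mset s N)" "\<And>e'. e' \<in># slot_items s \<Longrightarrow> col e' = col e"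
  shows "slots_inv j (add_mset (fill e s) N)"
proof -
  have "size (unused_slots l (add_mset (fill e s) N)) \<le> size (unused_slots l (add_mset s N))" for l
    by (simp add: unused_slots_def)
  then have "size (unused_slots l (add_mset (fill e s) N)) < 2 ^ (j - l)" for l
    using assms(1) le_less_trans unfolding slots_inv_def by blast
  moreover have "monochromatic (add_mset (fill e s) N)"
    using assms unfolding slots_inv_def monochromatic_def by auto
  ultimately show ?thesis by (simp add: slots_inv_def)
qed

lemma slots_inv_put_new:
  assumes "slots_inv j (slots B)" "unused_slots l (slots B) = {#}"
  shows "slots_inv j (slots (put_new j e l B))"
proof -
  let ?M = "slots B"
  have "unused_slots l' (replicate_mset n (Slot l False {#})) =
      (if l = l' then replicate_mset n (Slot l False {#}) else {#})" for l' n
    by (induction n) (auto simp: unused_slots_def)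
  then have "unused_slots l' (add_mset (Slot l False {#e#})
      (replicate_mset (2 ^ (j - l) - 1) (Slot l False {#}) + ?M)) =
      (if l = l' then replicate_mset (2 ^ (j - l) - 1) (Slot l False {#}) else {#}) +
      unused_slots l' ?M" for l'
    by (auto simp: unused_slots_def)
  then have "size (unused_slots l' (add_mset (Slot l False {#e#})
      (replicate_mset (2 ^ (j - l) - 1) (Slot l False {#}) + ?M))) < 2 ^ (j - l')" for l'
    using assms by (auto simp: slots_inv_def)
  moreover have "monochromatic (add_mset (Slot l False {#e#})
      (replicate_mset (2 ^ (j - l) - 1) (Slot l False {#}) + ?M))"
    using assms by (auto simp: slots_inv_def monochromatic_def split: if_splits)
  ultimately show ?thesis unfolding slots_put_new by (simp add: slots_inv_def)
qed

lemma of_colour_replicate_empty [simp]: "of_colour c (replicate_mset n (Slot l cl {#})) = {#}"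
  by (induction n) auto

text \<open>The least level exists and is at most \<open>j\<close>, because a level-\<open>j\<close>
  region is a whole bin and holds any item.\<close>

lemma next_level_props:
  assumes "colour_level B (col e) < j" "sz e \<le> 1"
  shows "colour_level B (col e) < next_level j B e" "next_level j B e \<le> j"
    "sz e \<le> region_size j (next_level j B e)"
    "\<And>l. colour_level B (col e) < l \<Longrightarrow> l < next_level j B e \<Longrightarrow> region_size j l < sz e"
proof -
  let ?P = "\<lambda>l. colour_level B (col e) < l \<and> sz e \<le> region_size j l"
  have j: "?P j" using assms by simp
  show "colour_level B (col e) < next_level j B e" "sz e \<le> region_size j (next_level j B e)"
    using LeastI[of ?P, OF j] by (simp_all add: next_level_def)
  show "next_level j B e \<le> j" unfolding next_level_def by (rule Least_le) (rule j)
  show "region_size j l < sz e" if "colour_level B (col e) < l" "l < next_level j B e" for l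
    using not_less_Least[of l ?P] that by (auto simp: next_level_def)
qed

text \<open>Transfers the analysis to the bins: the region touched is empty or holds only the colour
  of \<open>e\<close>, so no other colour sees the step.\<close>

lemma step_slots:
  assumes "step j B e B'" "bins_inv j B" "slots_inv j (slots B)" "sz e \<le> 1" "1 \<le> j"
  shows "bins_inv j B' \<and> slots_inv j (slots B') \<and>
    colour_step j (of_colour (col e) (slots B)) e (of_colour (col e) (slots B')) \<and>
    (\<forall>c. c \<noteq> col e \<longrightarrow> of_colour c (slots B') = of_colour c (slots B)) \<and>
    sum_list (map contents B') = add_mset e (sum_list (map contents B))"
  using assms
proof (induction rule: step.induct)
  case (mnf_fit B e k r)
  define s where "s = Slot (level (B ! k)) (closed (B ! k)) (regions (B ! k) ! r)"
  have kr: "k < length B" "r < length (regions (B ! k))"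
    "slot_level s = colour_level B (col e)" "has_colour (col e) (slot_items s)"
    "slot_load s + sz e \<le> region_size j (slot_level s)"
    using mnf_fit(2) by (auto simp: fitting_regions_def s_def)
  obtain N where N: "slots B = add_mset s N" "slots (put e k r B) = add_mset (fill e s) N"
    using slots_put[OF kr(1,2) s_def] by blast
  have mono: "col e' = col e" if "e' \<in># slot_items s" for e'
    using mnf_fit.prems(2) that kr(4) N by (auto simp: slots_inv_def intro: monochromaticD)
  then have other: "\<not> has_colour c (slot_items s)" if "c \<noteq> col e" for c
    using that by (auto simp: has_colour_def)
  have "colour_step j (add_mset s (of_colour (col e) N)) e (add_mset (fill e s) (of_colour (col e) N))"
    using mnf_fit(1) top_level_of_colour[of "col e" B] kr N
    by (intro colour_step.fit) auto
  then show ?case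
    using mnf_fit.prems kr N mono other slots_inv_fill bins_inv_put all_contents_put by auto
next
  case (mnf_unused_region B e k r)
  note nl = next_level_props[OF mnf_unused_region(1) mnf_unused_region.prems(3)]
  define s where "s = Slot (level (B ! k)) (closed (B ! k)) (regions (B ! k) ! r)"
  have kr: "k < length B" "r < length (regions (B ! k))"
    "slot_level s = next_level j B e" "slot_items s = {#}"
    using mnf_unused_region(3) by (auto simp: unused_regions_def s_def)
  obtain N where N: "slots B = add_mset s N" "slots (put e k r B) = add_mset (fill e s) N"
    using slots_put[OF kr(1,2) s_def] by blast
  have "size (unused_slots (slot_level s) (slots B)) \<noteq> 0"
    using N kr by (simp add: unused_slots_def)
  then have "next_level j B e \<noteq> j"
    using mnf_unused_region.prems(2) kr(3) unfolding slots_inv_def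
    by (metis diff_self_eq_0 less_one power_0)
  then have "colour_step j (of_colour (col e) (slots B)) e
     (add_mset (Slot (next_level j B e) (slot_closed s) {#e#}) (of_colour (col e) (slots B)))"
    using mnf_unused_region(1,2) nl unfolding top_level_of_colour[symmetric]
    by (intro colour_step.new_region)
      (auto simp: top_level_of_colour in_slots fitting_regions_def not_le; force simp: not_le)+
  moreover have "slots_inv j (slots (put e k r B))"
    using mnf_unused_region.prems(2) kr(4) unfolding N by (intro slots_inv_fill) auto
  moreover have "fill e s = Slot (next_level j B e) (slot_closed s) {#e#}"
    using kr by (simp add: fill_def)
  ultimately show ?case
    using mnf_unused_region.prems kr N bins_inv_put all_contents_put by auto
next
  case (mnf_new_bin B e)
  note nl = next_level_props[OF mnf_new_bin(1) mnf_new_bin.prems(3)]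
  have "unused_slots (next_level j B e) (slots B) = {#}"
    using mnf_new_bin(3) by (auto simp: unused_slots_empty_iff unused_regions_def in_slots)
  moreover have "colour_step j (of_colour (col e) (slots B)) e
     (add_mset (Slot (next_level j B e) False {#e#}) (of_colour (col e) (slots B)))"
    using mnf_new_bin(1,2) nl unfolding top_level_of_colour[symmetric]
    by (intro colour_step.new_region)
      (auto simp: top_level_of_colour in_slots fitting_regions_def not_le; force simp: not_le)+
  ultimately show ?case
    using mnf_new_bin.prems nl slots_inv_put_new bins_inv_put_new
    by (simp add: slots_put_new all_contents_put_new)
next
  case (bbf_fit B e k)
  define s where "s = Slot (level (B ! k)) (closed (B ! k)) (regions (B ! k) ! 0)"
  have k: "k \<in> open_isolated j B (col e)" "has_room B e k" and
    best: "\<And>k'. k' \<in> open_isolated j B (col e) \<Longrightarrow> has_room B e k' \<Longrightarrow>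
      load (contents (B ! k')) \<le> load (contents (B ! k))"
    using bbf_fit(2) by (auto simp: is_arg_max_def not_less)
  note ks = open_isolated_slot[OF bbf_fit.prems(1) k(1)]
  have s: "slot_level s = j" "\<not> slot_closed s" "slot_items s = contents (B ! k)"
    unfolding s_def ks(2) using ks by auto
  have r: "0 < length (regions (B ! k))" using ks(2) by simp
  obtain N where N: "slots B = add_mset s N" "slots (put e k 0 B) = add_mset (fill e s) N"
    using slots_put[OF ks(1) r s_def] by blast
  have mono: "col e' = col e" if "e' \<in># slot_items s" for e'
    using bbf_fit.prems(2) that ks(5) s N by (auto simp: slots_inv_def intro: monochromaticD)
  then have other: "\<not> has_colour c (slot_items s)" if "c \<noteq> col e" for c
    using that by (auto simp: has_colour_def)
  have "slot_load t \<le> slot_load s"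
    if "t \<in># open_slots j (of_colour (col e) N)" "slot_load t + sz e \<le> 1" for t
  proof -
    have "t \<in># open_slots j (of_colour (col e) (slots B))" using that N by simp
    then obtain k' where "k' \<in> open_isolated j B (col e)" "slot_items t = contents (B ! k')"
      using in_open_slots[OF bbf_fit.prems(1)] by blast
    then show ?thesis using best[of k'] that s by (simp add: has_room_def)
  qed
  then have "colour_step j (add_mset s (of_colour (col e) N)) e
      (add_mset (fill e s) (of_colour (col e) N))"
    using bbf_fit(1) top_level_of_colour[of "col e" B] ks s N k(2)
    by (intro colour_step.best_fit) (auto simp: has_room_def)
  moreover have "slots_inv j (slots (put e k 0 B))"
    using bbf_fit.prems(2) mono unfolding N by (rule slots_inv_fill)
  ultimately show ?case
    using bbf_fit.prems ks(1,5) s r N other bins_inv_put all_contents_put by auto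
next
  case (bbf_new_bin B e)
  have "1 < slot_load s + sz e" if "s \<in># open_slots j (of_colour (col e) (slots B))" for s
    using in_open_slots[OF bbf_new_bin.prems(1) that] bbf_new_bin(2)
    by (metis has_room_def not_le)
  then have "colour_step j (of_colour (col e) (slots B)) e
      (add_mset (Slot j False {#e#}) (of_colour (col e) (slots B)))"
    using bbf_new_bin(1,3) card_open_isolated[OF bbf_new_bin.prems(1)]
    by (intro colour_step.open_new) (auto simp: top_level_of_colour)
  moreover have "unused_slots j (slots B) = {#}"
    using bbf_new_bin.prems(2) unfolding slots_inv_def
    by (metis diff_self_eq_0 less_one power_0 size_eq_0_iff_empty)
  then have "slots_inv j (slots (put_new j e j B))"
    by (rule slots_inv_put_new[OF bbf_new_bin.prems(2)])
  ultimately show ?case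
    using bbf_new_bin.prems bins_inv_put_new by (simp add: slots_put_new all_contents_put_new)
next
  case (bbf_close B e k)
  define s where "s = Slot (level (B ! k)) (closed (B ! k)) (contents (B ! k))"
  have k: "k \<in> open_isolated j B (col e)" and
    best: "\<And>k'. k' \<in> open_isolated j B (col e) \<Longrightarrow>
      load (contents (B ! k')) \<le> load (contents (B ! k))"
    using bbf_close(4) by (auto simp: is_arg_max_def not_less)
  note ks = open_isolated_slot[OF bbf_close.prems(1) k(1)]
  have s: "slot_level s = j" "\<not> slot_closed s" "slot_items s = contents (B ! k)"
    unfolding s_def using ks by auto
  \<comment> \<open>The bin to be closed is one region and hence of one colour, so closing it
    changes no slot of another colour.\<close>
  have other: "\<not> has_colour c (contents (B ! k))" if "c \<noteq> col e" for c
  proof -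
    have "s \<in># slots B" using ks unfolding in_slots s_def by (intro exI[of _ k] exI[of _ 0]) auto
    then show ?thesis
      using bbf_close.prems(2) ks(5) s(3) that unfolding slots_inv_def
      by (metis monochromaticD has_colour_def)
  qed
  have "s \<in># slots B" using ks unfolding in_slots s_def by (intro exI[of _ k] exI[of _ 0]) auto
  then obtain N where N: "slots B = add_mset s N" by (meson multi_member_split)
  have closed: "slots (close_bin k B) = add_mset (Slot j True (slot_items s)) N"
    using slots_close[OF ks(1,2) s_def N] s by simp
  have full: "slot_load t \<le> slot_load s \<and> 1 < slot_load t + sz e"
    if "t \<in># open_slots j (of_colour (col e) N)" for t
  proof -
    have "t \<in># open_slots j (of_colour (col e) (slots B))" using that N by simp
    then obtain k' where "k' \<in> open_isolated j B (col e)" "slot_items t = contents (B ! k')"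
      using in_open_slots[OF bbf_close.prems(1)] by blast
    then show ?thesis using best[of k'] bbf_close(2) s by (auto simp: has_room_def)
  qed
  have "\<not> size (open_slots j (of_colour (col e) (slots B))) < 2"
    using bbf_close(3) card_open_isolated[OF bbf_close.prems(1)] by simp
  then have ne: "open_slots j (of_colour (col e) N) \<noteq> {#}"
    using N s ks(5) by auto
  have "colour_step j (add_mset s (of_colour (col e) N)) e
      (add_mset (Slot j False {#e#}) (add_mset (Slot j True (slot_items s)) (of_colour (col e) N)))"
    using bbf_close(1) top_level_of_colour[of "col e" B] ks s N full ne
    by (intro colour_step.close) auto
  moreover have "slots_inv j (slots (close_bin k B))"
  proof -
    have "slot_items s \<noteq> {#}" using s(3) ks(5) by auto
    then have "unused_slots l (slots (close_bin k B)) = unused_slots l (slots B)" for l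
      unfolding closed N by (simp add: unused_slots_def)
    moreover have "monochromatic (slots (close_bin k B))"
      using bbf_close.prems(2) unfolding closed N slots_inv_def monochromatic_def by auto
    ultimately show ?thesis using bbf_close.prems(2) by (simp add: slots_inv_def)
  qed
  then have "slots_inv j (slots (put_new j e j (close_bin k B)))"
    by (rule slots_inv_put_new)
      (metis \<open>slots_inv j (slots (close_bin k B))\<close> slots_inv_def diff_self_eq_0 less_one power_0
        size_eq_0_iff_empty)
  moreover have "bins_inv j (close_bin k B)"
    using bbf_close.prems(1) ks(1) by (rule bins_inv_close)
  ultimately show ?case
    using bbf_close.prems bins_inv_put_new[of j "close_bin k B" j e] ks(1,5) s N other
    by (auto simp: slots_put_new all_contents_put_new all_contents_close closed)
qed

section \<open>Runs\<close>

lemma ex_arg_max_finite: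
  fixes f :: "'a \<Rightarrow> real"
  assumes "finite A" "A \<noteq> {}"
  shows "\<exists>x. is_arg_max f (\<lambda>x. x \<in> A) x"
proof -
  have "Max (f ` A) \<in> f ` A" using assms by (intro Max_in) auto
  then obtain x where "x \<in> A" "f x = Max (f ` A)" by auto
  then show ?thesis using assms(1) by (auto simp: is_arg_max_def not_less intro!: exI[of _ x])
qed

text \<open>The rules exhaust all cases; where a fullest bin is required, it is chosen from a finite
  nonempty set.\<close>

lemma step_exists: "\<exists>B'. step j B e B'"
proof (cases "colour_level B (col e) < j")
  case True
  then show ?thesis
    by (cases "fitting_regions j B e = {}"; cases "unused_regions B (next_level j B e) = {}")
      (auto intro: step.intros)
next
  case False
  then have level: "j \<le> colour_level B (col e)" by simp
  have fin: "finite (open_isolated j B (col e))" by (simp add: open_isolated_def)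
  let ?A = "{k \<in> open_isolated j B (col e). has_room B e k}"
  consider "?A \<noteq> {}" | "?A = {}" "card (open_isolated j B (col e)) < 2"
    | "?A = {}" "\<not> card (open_isolated j B (col e)) < 2" by blast
  then show ?thesis
  proof cases
    case 1
    then obtain k where "is_arg_max (\<lambda>k. load (contents (B ! k))) (\<lambda>k. k \<in> ?A) k"
      using ex_arg_max_finite[of ?A] fin by auto
    then show ?thesis using level by (auto intro: step.bbf_fit)
  next
    case 2
    then show ?thesis using level by (auto intro!: exI step.bbf_new_bin)
  next
    case 3
    then have "open_isolated j B (col e) \<noteq> {}" by auto
    then obtain k where
      "is_arg_max (\<lambda>k. load (contents (B ! k))) (\<lambda>k. k \<in> open_isolated j B (col e)) k"
      using ex_arg_max_finite fin by blast
    then show ?thesis using level 3 by (auto intro!: exI step.bbf_close)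
  qed
qed

lemma run_exists: "\<exists>B. run j I B"
proof (induction I rule: rev_induct)
  case (snoc e I)
  then obtain B where "run j I B" by auto
  moreover obtain B' where "step j B e B'" using step_exists by blast
  ultimately show ?case by (auto intro: run_snoc)
qed (auto intro: run_Nil)

lemma colour_step_items:
  "colour_step j Q e Q' \<Longrightarrow> (\<Sum>s\<in>#Q'. slot_items s) = add_mset e (\<Sum>s\<in>#Q. slot_items s)"
  by (induction rule: colour_step.induct) auto

lemma run_inv:
  assumes "run j I B" "1 \<le> j" "is_instance (eps j) m I"
  shows "bins_inv j B \<and> slots_inv j (slots B) \<and> sum_list (map contents B) = mset I \<and>
    (\<forall>c. colour_inv j (of_colour c (slots B)) \<and>
      (\<Sum>s\<in>#of_colour c (slots B). slot_items s) = colour_class I c)"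
  using assms
proof (induction rule: run.induct)
  case run_Nil
  then show ?case
    by (simp add: bins_inv_def slots_inv_def monochromatic_def unused_slots_def colour_class_def
        colour_inv_empty)
next
  case (run_snoc I B e B')
  then have IH: "bins_inv j B" "slots_inv j (slots B)" "sum_list (map contents B) = mset I"
    "\<And>c. colour_inv j (of_colour c (slots B))"
    "\<And>c. (\<Sum>s\<in>#of_colour c (slots B). slot_items s) = colour_class I c"
    by (auto simp: is_instance_def)
  have e: "eps j \<le> sz e" "sz e \<le> 1" using run_snoc.prems by (auto simp: is_instance_def)
  note S = step_slots[OF run_snoc(2) IH(1,2) e(2) run_snoc.prems(1)]
  have "colour_inv j (of_colour c (slots B')) \<and>
      (\<Sum>s\<in>#of_colour c (slots B'). slot_items s) = colour_class (I @ [e]) c" for c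
  proof (cases "c = col e")
    case True
    then have "colour_step j (of_colour c (slots B)) e (of_colour c (slots B'))"
      using S by simp
    then show ?thesis
      using colour_inv_step[OF _ IH(4) e run_snoc.prems(1)] colour_step_items IH(5) True
      by (simp add: colour_class_def)
  next
    case False
    then show ?thesis using S IH(4,5) by (simp add: colour_class_def)
  qed
  then show ?case using S IH(3) by simp
qed

section \<open>Summation over colours and bins\<close>

lemma load_sum_mset: "load (\<Sum>s\<in>#Q. slot_items s) = (\<Sum>s\<in>#Q. slot_load s)"
  by (induction Q) auto

lemma total_weight_sum_mset:
  "total_weight (\<Sum>s\<in>#Q. slot_items s) = (\<Sum>s\<in>#Q. total_weight (slot_items s))"
  by (induction Q) auto

lemma sum_load_colour_classes:
  assumes "\<And>e. e \<in> set I \<Longrightarrow> col e \<in> {1..m}"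
  shows "(\<Sum>c = 1..m. load (colour_class I c)) = load (mset I)"
  using assms
proof (induction I)
  case (Cons e I)
  have "load (colour_class (e # I) c) = (if col e = c then sz e else 0) + load (colour_class I c)"
    for c by (simp add: colour_class_def)
  then show ?case using Cons by (simp add: sum.distrib)
qed (simp add: colour_class_def)

text \<open>Every nonempty slot occurs in the sum of at least one colour. Used with region sizes for
  the length of the packing and with an indicator for the open bins.\<close>

lemma sum_used_slots_le:
  fixes f :: "slot \<Rightarrow> real"
  assumes "\<And>s. s \<in># M \<Longrightarrow> slot_items s \<noteq> {#} \<Longrightarrow> \<exists>c\<in>{1..m}. has_colour c (slot_items s)"
    "\<And>s. 0 \<le> f s"
  shows "(\<Sum>s\<in>#filter_mset (\<lambda>s. slot_items s \<noteq> {#}) M. f s) \<le>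
    (\<Sum>c = 1..m. \<Sum>s\<in>#of_colour c M. f s)"
  using assms(1)
proof (induction M)
  case (add s M)
  have "(if slot_items s \<noteq> {#} then f s else 0) \<le>
      (\<Sum>c = 1..m. if has_colour c (slot_items s) then f s else 0)"
  proof (cases "slot_items s = {#}")
    case True
    then show ?thesis using assms(2) by (auto intro: sum_nonneg)
  next
    case False
    then obtain c where c: "c \<in> {1..m}" "has_colour c (slot_items s)"
      using add.prems[of s] by auto
    have "(if has_colour c (slot_items s) then f s else 0) \<le>
        (\<Sum>c = 1..m. if has_colour c (slot_items s) then f s else 0)"
      by (rule member_le_sum) (use c assms(2) in auto)
    then show ?thesis using False c by simp
  qed
  moreover have "(\<Sum>c = 1..m. \<Sum>t\<in>#of_colour c (add_mset s M). f t) =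
      (\<Sum>c = 1..m. if has_colour c (slot_items s) then f s else 0) +
      (\<Sum>c = 1..m. \<Sum>t\<in>#of_colour c M. f t)"
    unfolding sum.distrib[symmetric] by (intro sum.cong) auto
  ultimately show ?case using add by auto
qed simp

lemma full_bin: "l \<le> j \<Longrightarrow> 2 ^ (j - l) * region_size j l = 1"
  by (simp add: region_size_def eps_def power_add[symmetric])

lemma length_eq_region_sizes:
  assumes "bins_inv j B"
  shows "length B = (\<Sum>s\<in>#slots B. region_size j (slot_level s))"
  using assms
proof (induction B)
  case (Cons b B)
  have "(\<Sum>s\<in>#bin_slots b. region_size j (slot_level s)) =
      length (regions b) * region_size j (level b)"
  proof -
    have "(\<Sum>X\<in>#M. region_size j (level b)) = size M * region_size j (level b)"
      for M :: "item multiset multiset" by (simp add: sum_mset_constant)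
    then show ?thesis by (simp add: bin_slots_def image_mset.compositionality comp_def)
  qed
  also have "\<dots> = 1" using Cons.prems full_bin[of "level b" j] by (simp add: bins_inv_def)
  finally show ?case using Cons by (simp add: bins_inv_def)
qed simp

lemma in_slots_bin: "b \<in> set B \<Longrightarrow> X \<in> set (regions b) \<Longrightarrow> Slot (level b) (closed b) X \<in># slots B"
  by (auto simp: in_slots in_set_conv_nth)

section \<open>Bounds for a run on a fixed instance\<close>

context
  fixes j m :: nat and I :: "item list" and B :: "bin list"
  assumes j: "1 \<le> j" and inst: "is_instance (eps j) m I" and run: "run j I B"
begin

lemma run_facts:
  "bins_inv j B" "slots_inv j (slots B)" "sum_list (map contents B) = mset I"
  "colour_inv j (of_colour c (slots B))"
  "(\<Sum>s\<in>#of_colour c (slots B). slot_items s) = colour_class I c"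
  using run_inv[OF run j inst] by auto

lemma item_facts:
  assumes "e \<in> set I"
  shows "0 \<le> sz e" "sz e \<le> 1" "col e \<in> {1..m}"
  using assms inst region_size_pos[of j 0] by (auto simp: is_instance_def region_size_0 dest!: bspec)

lemma slot_colour:
  assumes "s \<in># slots B" "slot_items s \<noteq> {#}"
  shows "\<exists>c\<in>{1..m}. has_colour c (slot_items s)"
proof -
  obtain e where e: "e \<in># slot_items s" using assms(2) by blast
  then have "s \<in># of_colour (col e) (slots B)" using assms(1) by (auto simp: has_colour_def)
  then have "e \<in># (\<Sum>s\<in>#of_colour (col e) (slots B). slot_items s)" using e by auto
  then have "e \<in># colour_class I (col e)" by (simp only: run_facts)
  then have "e \<in> set I" by (simp add: colour_class_def)
  then show ?thesis using item_facts(3) e by (auto simp: has_colour_def)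
qed

lemma run_is_packing: "is_packing (map contents B) (mset I)"
proof -
  have "load (contents b) \<le> 1" if b: "b \<in> set B" for b
  proof -
    have "load X \<le> region_size j (level b)" if X: "X \<in> set (regions b)" for X
    proof (cases "X = {#}")
      case False
      note s = in_slots_bin[OF b X]
      obtain c where "has_colour c X" using slot_colour[OF s] False by auto
      then have "Slot (level b) (closed b) X \<in># of_colour c (slots B)" using s by simp
      then show ?thesis using run_facts(4)[of c] by (force simp: colour_inv_def items_inv_def)
    qed (simp add: less_imp_le region_size_pos)
    then have "load (sum_list Xs) \<le> length Xs * region_size j (level b)"
      if "set Xs \<subseteq> set (regions b)" for Xs
      using that by (induction Xs) (force simp: algebra_simps)+
    from this[of "regions b"] show ?thesis
      using b run_facts(1) full_bin[of "level b" j] by (auto simp: contents_def bins_inv_def)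
  qed
  then show ?thesis using run_facts(3) by (simp add: is_packing_def)
qed

lemma unused_region_sizes_le:
  "(\<Sum>s\<in>#filter_mset (\<lambda>s. slot_items s = {#}) (slots B). region_size j (slot_level s)) \<le> j + 1"
proof -
  let ?U = "filter_mset (\<lambda>s. slot_items s = {#}) (slots B)"
  have "slot_level s \<le> j" if "s \<in># ?U" for s
    using that run_facts(1) by (auto simp: in_slots bins_inv_def)
  then have "(\<Sum>s\<in>#?U. region_size j (slot_level s)) =
      (\<Sum>l\<le>j. \<Sum>s\<in>#at_level l ?U. region_size j (slot_level s))"
    by (rule sum_mset_by_level)
  also have "\<dots> \<le> (\<Sum>l\<le>j. 1)"
  proof (rule sum_mono)
    fix l assume "l \<in> {..j}"
    have "at_level l ?U = unused_slots l (slots B)"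
      by (simp add: at_level_def unused_slots_def filter_filter_mset conj_commute)
    moreover have "(\<Sum>s\<in>#unused_slots l M. region_size j (slot_level s)) =
        size (unused_slots l M) * region_size j l" for M
      by (induction M) (auto simp: unused_slots_def algebra_simps)
    ultimately have "(\<Sum>s\<in>#at_level l ?U. region_size j (slot_level s)) =
        size (unused_slots l (slots B)) * region_size j l" by simp
    also have "size (unused_slots l (slots B)) \<le> (2::real) ^ (j - l)"
      using run_facts(2) unfolding slots_inv_def
      by (metis less_imp_le of_nat_le_iff of_nat_numeral of_nat_power)
    finally show "(\<Sum>s\<in>#at_level l ?U. region_size j (slot_level s)) \<le> 1"
      using full_bin[of l j] \<open>l \<in> {..j}\<close> region_size_pos[of j l]
      by (simp add: mult_right_mono)
  qed
  finally show ?thesis by simp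
qed

text \<open>Used regions are charged to their colours at three times the load; the loads of the
  colours add up to that of the instance, which bounds the optimum from below.\<close>

lemma run_length_le: "length B \<le> 3 * real (OPT (mset I)) + j + 1"
proof -
  let ?r = "\<lambda>s. region_size j (slot_level s)"
  have split: "(\<Sum>s\<in>#M. ?r s) = (\<Sum>s\<in>#filter_mset (\<lambda>s. slot_items s \<noteq> {#}) M. ?r s) +
      (\<Sum>s\<in>#filter_mset (\<lambda>s. slot_items s = {#}) M. ?r s)" for M
    by (induction M) auto
  have "length B = (\<Sum>s\<in>#slots B. ?r s)" by (rule length_eq_region_sizes) (rule run_facts)
  also have "\<dots> = (\<Sum>s\<in>#filter_mset (\<lambda>s. slot_items s \<noteq> {#}) (slots B). ?r s) +
      (\<Sum>s\<in>#filter_mset (\<lambda>s. slot_items s = {#}) (slots B). ?r s)"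
    by (rule split)
  also have "\<dots> \<le> (\<Sum>c = 1..m. \<Sum>s\<in>#of_colour c (slots B). ?r s) + (j + 1)"
    using unused_region_sizes_le slot_colour
    by (intro add_mono sum_used_slots_le) (auto simp: less_imp_le region_size_pos)
  also have "(\<Sum>c = 1..m. \<Sum>s\<in>#of_colour c (slots B). ?r s) \<le>
      (\<Sum>c = 1..m. 3 * load (colour_class I c))"
    using colour_region_sizes_le[OF run_facts(4) j]
    by (intro sum_mono) (simp flip: run_facts(5) add: load_sum_mset)
  also have "\<dots> = 3 * load (mset I)"
    using sum_load_colour_classes[OF item_facts(3)] by (simp add: sum_distrib_left[symmetric])
  also have "\<dots> \<le> 3 * real (OPT (mset I))"
    using load_le_OPT[of "mset I"] item_facts(2) by simp
  finally show ?thesis by simp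
qed

text \<open>Each bin showing the colour has a slot of it, and the slots are counted by the weight of
  the colour class.\<close>

lemma run_colour_bins_le:
  "colour_bins c (map contents B) \<le> 17/10 * real (OPT (colour_class I c)) + j + 13/10"
proof -
  have "colour_bins c (map contents B) \<le> size (of_colour c (slots B))"
  proof (induction B)
    case (Cons b B)
    have "of_colour c (bin_slots b) \<noteq> {#}" if "has_colour c (contents b)"
    proof -
      obtain X where "X \<in> set (regions b)" "has_colour c X"
        using \<open>has_colour c (contents b)\<close> by (auto simp: has_colour_contents)
      then have "Slot (level b) (closed b) X \<in># of_colour c (bin_slots b)"
        by (simp add: bin_slots_def)
      then show ?thesis by (metis empty_iff set_mset_empty)
    qed
    then have "has_colour c (contents b) \<longrightarrow> 1 \<le> size (of_colour c (bin_slots b))"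
      by (simp add: Suc_le_eq nonempty_has_size)
    then show ?case using Cons by (auto simp: colour_bins_def)
  qed (simp add: colour_bins_def)
  also have "size (of_colour c (slots B)) \<le> total_weight (colour_class I c) + j + 13/10"
    using colour_count_le[OF run_facts(4) j, of c] run_facts(5)[of c]
    by (simp flip: total_weight_sum_mset)
  also have "total_weight (colour_class I c) \<le> 17/10 * real (OPT (colour_class I c))"
    using item_facts by (intro total_weight_le_OPT) (auto simp: colour_class_def)
  finally show ?thesis by simp
qed

text \<open>An open bin is nonempty, so it has a used slot that is not closed, and each colour has
  at most j + 1 of these.\<close>

lemma run_open_bins_le: "real (open_bins B) \<le> (j + 1) * real m"
proof -
  let ?f = "\<lambda>s. if slot_closed s then 0 else 1 :: real"
  have f: "(\<Sum>s\<in>#M. ?f s) = size (filter_mset (\<lambda>s. \<not> slot_closed s) M)" for M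
    by (induction M) auto
  have "open_bins B \<le>
      size (filter_mset (\<lambda>s. \<not> slot_closed s \<and> slot_items s \<noteq> {#}) (slots B))"
    using run_facts(1)
  proof (induction B)
    case (Cons b B)
    have "\<exists>X\<in>set (regions b). X \<noteq> {#}"
    proof -
      have "sum_list Xs = {#}" if "\<forall>X\<in>set Xs. X = {#}" for Xs :: "item multiset list"
        using that by (induction Xs) auto
      then show ?thesis using Cons.prems by (auto simp: bins_inv_def contents_def)
    qed
    then obtain X where "X \<in> set (regions b)" "X \<noteq> {#}" by auto
    then have "Slot (level b) (closed b) X \<in># bin_slots b" by (simp add: bin_slots_def)
    then have "\<not> closed b \<Longrightarrow> Slot (level b) (closed b) X \<in>#
        filter_mset (\<lambda>s. \<not> slot_closed s \<and> slot_items s \<noteq> {#}) (bin_slots b)"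
      using \<open>X \<noteq> {#}\<close> by simp
    then have "\<not> closed b \<Longrightarrow>
        1 \<le> size (filter_mset (\<lambda>s. \<not> slot_closed s \<and> slot_items s \<noteq> {#}) (bin_slots b))"
      by (metis One_nat_def Suc_leI empty_iff nonempty_has_size set_mset_empty)
    then show ?case using Cons by (auto simp: open_bins_def bins_inv_def)
  qed (simp add: open_bins_def)
  also have "\<dots> = (\<Sum>s\<in>#filter_mset (\<lambda>s. slot_items s \<noteq> {#}) (slots B). ?f s)"
    unfolding f by (simp add: filter_filter_mset conj_commute)
  also have "\<dots> \<le> (\<Sum>c = 1..m. \<Sum>s\<in>#of_colour c (slots B). ?f s)"
    using slot_colour by (intro sum_used_slots_le) auto
  also have "\<dots> \<le> (\<Sum>c = 1..m. real (j + 1))"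
    unfolding f using colour_open_count_le[OF run_facts(4) j] by (intro sum_mono) (simp only: of_nat_le_iff)
  finally show ?thesis by (simp add: mult.commute)
qed

end

theorem theorem5:
  "(\<exists>C::real. \<forall>j\<ge>1. \<forall>m I. is_instance (eps j) m I \<longrightarrow>
      (\<exists>P. produces j I P) \<and>
      (\<forall>P. produces j I P \<longrightarrow>
         is_packing P (mset I) \<and>
         real (length P) \<le> 3 * real (OPT (mset I)) + C * log 2 (1 / eps j) \<and>
         (\<forall>c\<in>{1..m}. real (colour_bins c P)
            \<le> 1.7 * real (OPT (colour_class I c)) + C * log 2 (1 / eps j)))) \<and>
   (\<forall>j\<ge>1. approximation_algorithm (eps j) 3 1.7 (produces j)) \<and>
   (\<forall>j\<ge>1. \<exists>K::real. \<forall>m I. is_instance (eps j) m I \<longrightarrow>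
      (\<forall>t\<le>length I. \<forall>B. run j (take t I) B \<longrightarrow> real (open_bins B) \<le> K * real m))"
proof (intro conjI)
  have log: "log 2 (1 / eps j) = j" for j
    by (simp add: eps_def log_nat_power)
  have ex: "\<exists>P. produces j I P" for j I
    using run_exists by (auto simp: produces_def)
  have bound: "is_packing P (mset I) \<and>
      real (length P) \<le> 3 * real (OPT (mset I)) + 3 * j \<and>
      (\<forall>c. real (colour_bins c P) \<le> 1.7 * real (OPT (colour_class I c)) + 3 * j)"
    if prems: "1 \<le> j" "is_instance (eps j) m I" "produces j I P" for j m I P
  proof -
    obtain B where B: "run j I B" "P = map contents B"
      using prems(3) by (auto simp: produces_def)
    note run = prems(1,2) B(1)
    \<comment> \<open>Lets 3 j absorb both additive terms, j + 1 and j + 13/10.\<close>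
    have "1 \<le> real j" using prems(1) by simp
    then have "real (colour_bins c P) \<le> 1.7 * real (OPT (colour_class I c)) + 3 * j" for c
      using run_colour_bins_le[OF run, of c] unfolding B by linarith
    then show ?thesis
      using run_is_packing[OF run] run_length_le[OF run] \<open>1 \<le> real j\<close> unfolding B by auto
  qed
  show "\<exists>C::real. \<forall>j\<ge>1. \<forall>m I. is_instance (eps j) m I \<longrightarrow>
      (\<exists>P. produces j I P) \<and>
      (\<forall>P. produces j I P \<longrightarrow>
         is_packing P (mset I) \<and>
         real (length P) \<le> 3 * real (OPT (mset I)) + C * log 2 (1 / eps j) \<and>
         (\<forall>c\<in>{1..m}. real (colour_bins c P)
            \<le> 1.7 * real (OPT (colour_class I c)) + C * log 2 (1 / eps j)))"
    unfolding log using ex bound by (intro exI[of _ 3]) simp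
  show "\<forall>j\<ge>1. approximation_algorithm (eps j) 3 1.7 (produces j)"
  proof (intro allI impI)
    fix j :: nat assume "1 \<le> j"
    then show "approximation_algorithm (eps j) 3 1.7 (produces j)"
      unfolding approximation_algorithm_def
      using ex bound by (intro exI[of _ "3 * real j"]) simp
  qed
  show "\<forall>j\<ge>1. \<exists>K::real. \<forall>m I. is_instance (eps j) m I \<longrightarrow>
      (\<forall>t\<le>length I. \<forall>B. run j (take t I) B \<longrightarrow> real (open_bins B) \<le> K * real m)"
  proof (intro allI impI)
    fix j :: nat assume j: "1 \<le> j"
    have "real (open_bins B) \<le> real (j + 1) * real m"
      if "is_instance (eps j) m I" "run j (take t I) B" for m I t B
    proof -
      \<comment> \<open>A prefix is an instance with the same colours, so the bound on open bins
        holds at every moment.\<close>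
      have "is_instance (eps j) m (take t I)"
        using that(1) by (auto simp: is_instance_def dest: in_set_takeD)
      then show ?thesis using run_open_bins_le[OF j _ that(2)] by simp
    qed
    then show "\<exists>K::real. \<forall>m I. is_instance (eps j) m I \<longrightarrow>
      (\<forall>t\<le>length I. \<forall>B. run j (take t I) B \<longrightarrow> real (open_bins B) \<le> K * real m)"
      by blast
  qed
qed

end
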